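(* The eigenvalues of the boundary value problem (P) coincide with the eigenvalues of the operator $A$, and the eigenfunctions of (P) are the first components of the corresponding eigenelements of $A$. That is, $\lambda\in\mathbb{C}$ is an eigenvalue of (P) if and only if $\lambda$ is an eigenvalue of $A$, and the eigenfunctions of (P) corresponding to $\lambda$ are exactly the first components $f$ of the nonzero elements $F=(f,h_1,h_2,h_3,h_4)\in D(A)$ with $AF=\lambda F$.
   Context: Let $I=[-1,0)\cup(0,1]$. Let $a(x)=a_1^4$ for $x\in[-1,0)$ and $a(x)=a_2^4$ for $x\in(0,1]$, where $a_1,a_2>0$ are given real numbers. Let $q$ be a real-valued function continuous on $[-1,0)\cup(0,1]$ with finite limits $q(0\pm)=\lim_{x\to0\pm}q(x)$. Let $\beta_1,\beta_2,\delta_1,\delta_2$ be real with $|\beta_1|+|\beta_2|\neq0$ and $|\delta_1|+|\delta_2|\neq0$. Let $\lambda$ be a complex eigenvalue parameter. Problem (P) consists of the differential equation $$Lu:=(a(x)u''(x))''+q(x)u(x)=\lambda u(x),\quad x\in I,$$ together with the conditions $L_1u:=u(-1)=0$, $L_2u:=\beta_1u'(-1)+\beta_2u''(-1)=0$, $L_3u:=u(0+)-u(0-)=0$, $L_4u:=u'(0+)-u'(0-)=0$, $L_5u:=u''(0+)-u''(0-)+\lambda\delta_1u'(0-)=0$, $L_6u:=u'''(0+)-u'''(0-)+\lambda\delta_2u(0-)=0$, $L_7u:=\lambda u(1)+u'''(1)=0$, $L_8u:=\lambda u'(1)+u''(1)=0$. An eigenvalue of (P) is a $\lambda\in\mathbb{C}$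 for which (P) has a nontrivial solution; such solutions are the corresponding eigenfunctions. $L^2(I)$ carries the inner product $\langle f,g\rangle_1=\frac{1}{a_1^4}\int_{-1}^0 f\overline{g}\,dx+\frac1{a_2^4}\int_0^1 f\overline{g}\,dx$. The space $Z=L^2(I)\oplus\mathbb{C}\oplus\mathbb{C}\oplus\mathbb{C}_{\delta_1}\oplus\mathbb{C}_{\delta_2}$ has as underlying vector space $L^2(I)\oplus\mathbb{C}^4$ (here $\mathbb{C}_{\delta_i}$ is $\mathbb{C}$ with an inner product depending on $\delta_i$). The linear operator $A$ in $Z$ has domain $D(A)$ consisting of all $F=(f,h_1,h_2,h_3,h_4)\in Z$ such that, writing $f_1=f|_{[-1,0)}$ and $f_2=f|_{(0,1]}$, one has $f_1^{(i)}\in AC_{loc}((-1,0))$ and $f_2^{(i)}\in AC_{loc}((0,1))$ for $i=0,1,2,3$; $Lf\in L^2(I)$; $L_kf=0$ for $k=1,2,3,4$; and $h_1=f(1)$, $h_2=f'(1)$, $h_3=-\delta_1f'(0)$, $h_4=-\delta_2f(0)$. Here values at the endpoints and at $0$ are understood as one-sided limits ($f(0)$ and $f'(0)$ being the common one-sided limits). The action of $A$ is $$AF=\bigl(Lf,\,-f'''(1),\,-f''(1),\,f''(0+)-f''(0-),\,f'''(0+)-f'''(0-)\bigr).$$ *)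

theory Defs
  imports "HOL-Analysis.Analysis"
begin

section \<open>The interval and the space \<open>L\<^sup>2\<close>\<close>

definition II :: "real set" where
  "II = {-1..<0} \<union> {0<..1}"

definition sq_int :: "(real \<Rightarrow> complex) \<Rightarrow> bool" where
  "sq_int f \<longleftrightarrow> f \<in> borel_measurable (lebesgue_on II) \<and>
     integrable (lebesgue_on II) (\<lambda>x. (cmod (f x))\<^sup>2)"

definition l2_rel :: "(real \<Rightarrow> complex) \<Rightarrow> (real \<Rightarrow> complex) \<Rightarrow> bool" where
  "l2_rel f g \<longleftrightarrow> sq_int f \<and> sq_int g \<and> (AE x in lebesgue_on II. f x = g x)"

lemma sq_int_add:
  assumes "sq_int f" "sq_int g" shows "sq_int (\<lambda>x. f x + g x)"
proof -
  have [measurable]: "f \<in> borel_measurable (lebesgue_on II)" "g \<in> borel_measurable (lebesgue_on II)"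
    using assms by (auto simp: sq_int_def)
  have "integrable (lebesgue_on II) (\<lambda>x. 2 * (cmod (f x))\<^sup>2 + 2 * (cmod (g x))\<^sup>2)"
    using assms by (auto simp: sq_int_def)
  then have "integrable (lebesgue_on II) (\<lambda>x. (cmod (f x + g x))\<^sup>2)"
  proof (rule Bochner_Integration.integrable_bound)
    show "AE x in lebesgue_on II. norm ((cmod (f x + g x))\<^sup>2)
        \<le> norm (2 * (cmod (f x))\<^sup>2 + 2 * (cmod (g x))\<^sup>2)"
    proof (rule AE_I2)
      fix x
      have "(cmod (f x + g x))\<^sup>2 \<le> (cmod (f x) + cmod (g x))\<^sup>2"
        by (simp add: norm_triangle_ineq power_mono)
      also have "\<dots> \<le> 2 * (cmod (f x))\<^sup>2 + 2 * (cmod (g x))\<^sup>2"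
        using sum_squares_bound[of "cmod (f x)" "cmod (g x)"] by (simp add: power2_sum)
      finally show "norm ((cmod (f x + g x))\<^sup>2)
          \<le> norm (2 * (cmod (f x))\<^sup>2 + 2 * (cmod (g x))\<^sup>2)"
        by simp
    qed
  qed measurable
  then show ?thesis by (simp add: sq_int_def)
qed

lemma sq_int_scale: "sq_int f \<Longrightarrow> sq_int (\<lambda>x. c * f x)"
  by (auto simp: sq_int_def norm_mult power_mult_distrib)

lemma sq_int_zero: "sq_int (\<lambda>x. 0)"
  by (simp add: sq_int_def)

quotient_type l2 = "real \<Rightarrow> complex" / partial: l2_rel
proof (rule part_equivpI)
  show "\<exists>f. l2_rel f f"
    by (rule exI[of _ "\<lambda>x. 0"]) (simp add: l2_rel_def sq_int_zero)
  show "symp l2_rel"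
    by (auto simp: symp_def l2_rel_def elim: AE_mp)
  show "transp l2_rel"
    unfolding transp_def l2_rel_def by (metis (mono_tags, lifting) AE_mp AE_I2)
qed

text \<open>\<open>abs_l2 f\<close> is the class of \<open>f\<close>; it is meaningful for square-integrable \<open>f\<close> only.\<close>

definition represents :: "(real \<Rightarrow> complex) \<Rightarrow> l2 \<Rightarrow> bool" where
  "represents u f \<longleftrightarrow> sq_int u \<and> abs_l2 u = f"

instantiation l2 :: ab_group_add
begin

lift_definition zero_l2 :: l2 is "\<lambda>x. 0"
  by (simp add: l2_rel_def sq_int_zero)

lift_definition plus_l2 :: "l2 \<Rightarrow> l2 \<Rightarrow> l2" is "\<lambda>f g x. f x + g x"
  unfolding l2_rel_def by (auto intro: sq_int_add)

lift_definition uminus_l2 :: "l2 \<Rightarrow> l2" is "\<lambda>f x. - f x"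
  unfolding l2_rel_def using sq_int_scale[of _ "-1"] by auto

definition minus_l2 :: "l2 \<Rightarrow> l2 \<Rightarrow> l2" where
  "minus_l2 f g = f + - g"

instance
proof
  fix f g h :: l2
  show "f + g + h = f + (g + h)"
    by transfer (auto simp: l2_rel_def add.assoc intro!: sq_int_add)
  show "f + g = g + f"
    by transfer (auto simp: l2_rel_def add.commute intro!: sq_int_add)
  show "0 + f = f"
    by transfer (auto simp: l2_rel_def)
  show "- f + f = 0"
    by transfer (auto simp: l2_rel_def sq_int_zero)
  show "f - g = f + - g"
    by (rule minus_l2_def)
qed

end

lift_definition scale_l2 :: "complex \<Rightarrow> l2 \<Rightarrow> l2" is "\<lambda>c f x. c * f x"
  unfolding l2_rel_def by (auto intro: sq_int_scale)

text \<open>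
  The vector space underlying \<open>L\<^sup>2(I) \<oplus> \<complex>\<^sup>4\<close>. The weights in the inner product
  (\<open>1/a\<^sub>1\<^sup>4\<close>, \<open>1/a\<^sub>2\<^sup>4\<close>, and those depending on \<open>\<delta>\<^sub>1\<close>, \<open>\<delta>\<^sub>2\<close>) change neither the set
  of square-integrable functions nor the eigenvalue equation, so they do not appear here.
\<close>

type_synonym Z = "l2 \<times> complex \<times> complex \<times> complex \<times> complex"

definition scale_Z :: "complex \<Rightarrow> Z \<Rightarrow> Z" where
  "scale_Z c = (\<lambda>(f, h1, h2, h3, h4). (scale_l2 c f, c * h1, c * h2, c * h3, c * h4))"

lemma vector_space_l2: "vector_space scale_l2"
proof
  fix a b :: complex and x y :: l2
  show "scale_l2 a (x + y) = scale_l2 a x + scale_l2 a y"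
    by transfer (auto simp: l2_rel_def distrib_left intro!: sq_int_scale sq_int_add)
  show "scale_l2 (a + b) x = scale_l2 a x + scale_l2 b x"
    by transfer (auto simp: l2_rel_def distrib_right intro!: sq_int_scale sq_int_add)
  show "scale_l2 a (scale_l2 b x) = scale_l2 (a * b) x"
    by transfer (auto simp: l2_rel_def mult.assoc intro!: sq_int_scale)
  show "scale_l2 1 x = x"
    by transfer (auto simp: l2_rel_def)
qed

lemma vector_space_Z: "vector_space scale_Z"
proof -
  interpret l: vector_space scale_l2 by (rule vector_space_l2)
  show ?thesis
    by unfold_locales
      (auto simp: scale_Z_def algebra_simps l.scale_right_distrib l.scale_left_distrib)
qed

section \<open>Absolute continuity\<close>

text \<open>
  The members of a division are non-overlapping compact intervals \<open>k = {Inf k..Sup k}\<close>.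
\<close>

definition abs_cont_on :: "real set \<Rightarrow> (real \<Rightarrow> complex) \<Rightarrow> bool" where
  "abs_cont_on T f \<longleftrightarrow>
     (\<forall>\<epsilon>>0. \<exists>\<delta>>0. \<forall>d S. d division_of S \<and> S \<subseteq> T \<and> (\<Sum>k\<in>d. Sup k - Inf k) < \<delta>
        \<longrightarrow> (\<Sum>k\<in>d. norm (f (Sup k) - f (Inf k))) < \<epsilon>)"

definition AC_loc :: "real set \<Rightarrow> (real \<Rightarrow> complex) \<Rightarrow> bool" where
  "AC_loc T f \<longleftrightarrow> (\<forall>c d. {c..d} \<subseteq> T \<longrightarrow> abs_cont_on {c..d} f)"

section \<open>The differential expression and the boundary and transmission conditions\<close>

text \<open>The derivative is taken within \<open>I\<close>, hence is one-sided at \<open>-1\<close> and \<open>1\<close> and two-sided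
  at all other points of \<open>I\<close>.\<close>

definition D :: "(real \<Rightarrow> complex) \<Rightarrow> real \<Rightarrow> complex" where
  "D u x = vector_derivative u (at x within II)"

abbreviation Dn :: "nat \<Rightarrow> (real \<Rightarrow> complex) \<Rightarrow> real \<Rightarrow> complex" where
  "Dn i u \<equiv> (D ^^ i) u"

definition coeff_a :: "real \<Rightarrow> real \<Rightarrow> real \<Rightarrow> real" where
  "coeff_a a1 a2 x = (if x < 0 then a1 ^ 4 else a2 ^ 4)"

definition au2 :: "real \<Rightarrow> real \<Rightarrow> (real \<Rightarrow> complex) \<Rightarrow> real \<Rightarrow> complex" where
  "au2 a1 a2 u x = complex_of_real (coeff_a a1 a2 x) * Dn 2 u x"

definition L :: "real \<Rightarrow> real \<Rightarrow> (real \<Rightarrow> real) \<Rightarrow> (real \<Rightarrow> complex) \<Rightarrow> real \<Rightarrow> complex" where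
  "L a1 a2 q u x = Dn 2 (au2 a1 a2 u) x + complex_of_real (q x) * u x"

text \<open>
  All boundary values are one-sided limits. At \<open>-1\<close> and \<open>1\<close> they agree with the point values
  whenever the function is continuous there (as a classical solution and its derivatives are).
\<close>

definition at_m1 :: "(real \<Rightarrow> complex) \<Rightarrow> complex" where "at_m1 u = Lim (at_right (-1)) u"
definition at_0m :: "(real \<Rightarrow> complex) \<Rightarrow> complex" where "at_0m u = Lim (at_left 0) u"
definition at_0p :: "(real \<Rightarrow> complex) \<Rightarrow> complex" where "at_0p u = Lim (at_right 0) u"
definition at_p1 :: "(real \<Rightarrow> complex) \<Rightarrow> complex" where "at_p1 u = Lim (at_left 1) u"

definition L1 :: "(real \<Rightarrow> complex) \<Rightarrow> complex" where
  "L1 u = at_m1 u"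

definition L2 :: "real \<Rightarrow> real \<Rightarrow> (real \<Rightarrow> complex) \<Rightarrow> complex" where
  "L2 \<beta>1 \<beta>2 u = of_real \<beta>1 * at_m1 (Dn 1 u) + of_real \<beta>2 * at_m1 (Dn 2 u)"

definition L3 :: "(real \<Rightarrow> complex) \<Rightarrow> complex" where
  "L3 u = at_0p u - at_0m u"

definition L4 :: "(real \<Rightarrow> complex) \<Rightarrow> complex" where
  "L4 u = at_0p (Dn 1 u) - at_0m (Dn 1 u)"

definition L5 :: "real \<Rightarrow> complex \<Rightarrow> (real \<Rightarrow> complex) \<Rightarrow> complex" where
  "L5 \<delta>1 \<mu> u = at_0p (Dn 2 u) - at_0m (Dn 2 u) + \<mu> * of_real \<delta>1 * at_0m (Dn 1 u)"

definition L6 :: "real \<Rightarrow> complex \<Rightarrow> (real \<Rightarrow> complex) \<Rightarrow> complex" where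
  "L6 \<delta>2 \<mu> u = at_0p (Dn 3 u) - at_0m (Dn 3 u) + \<mu> * of_real \<delta>2 * at_0m u"

definition L7 :: "complex \<Rightarrow> (real \<Rightarrow> complex) \<Rightarrow> complex" where
  "L7 \<mu> u = \<mu> * at_p1 u + at_p1 (Dn 3 u)"

definition L8 :: "complex \<Rightarrow> (real \<Rightarrow> complex) \<Rightarrow> complex" where
  "L8 \<mu> u = \<mu> * at_p1 (Dn 1 u) + at_p1 (Dn 2 u)"

section \<open>Problem (P)\<close>

text \<open>
  A solution is classical: the derivatives occurring in \<open>Lu\<close> exist at every point of \<open>I\<close>, the
  equation holds at every point of \<open>I\<close>, and the one-sided limits \<open>u\<^sup>(\<^sup>i\<^sup>)(0\<plusminus>)\<close>, \<open>i \<le> 3\<close>,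
  to which the transmission conditions refer exist.
\<close>

definition P_solution ::
  "real \<Rightarrow> real \<Rightarrow> (real \<Rightarrow> real) \<Rightarrow> real \<Rightarrow> real \<Rightarrow> real \<Rightarrow> real \<Rightarrow> complex \<Rightarrow> (real \<Rightarrow> complex) \<Rightarrow> bool"
where
  "P_solution a1 a2 q \<beta>1 \<beta>2 \<delta>1 \<delta>2 \<mu> u \<longleftrightarrow>
     (\<forall>x\<in>II. (\<forall>i<2. Dn i u differentiable (at x within II) \<and>
                     Dn i (au2 a1 a2 u) differentiable (at x within II))) \<and>
     (\<forall>x\<in>II. L a1 a2 q u x = \<mu> * u x) \<and>
     (\<forall>i\<le>3. (\<exists>l. (Dn i u \<longlongrightarrow> l) (at_left 0)) \<and> (\<exists>l. (Dn i u \<longlongrightarrow> l) (at_right 0))) \<and>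
     L1 u = 0 \<and> L2 \<beta>1 \<beta>2 u = 0 \<and> L3 u = 0 \<and> L4 u = 0 \<and>
     L5 \<delta>1 \<mu> u = 0 \<and> L6 \<delta>2 \<mu> u = 0 \<and> L7 \<mu> u = 0 \<and> L8 \<mu> u = 0"

definition P_eigenfunction ::
  "real \<Rightarrow> real \<Rightarrow> (real \<Rightarrow> real) \<Rightarrow> real \<Rightarrow> real \<Rightarrow> real \<Rightarrow> real \<Rightarrow> complex \<Rightarrow> (real \<Rightarrow> complex) \<Rightarrow> bool"
where
  "P_eigenfunction a1 a2 q \<beta>1 \<beta>2 \<delta>1 \<delta>2 \<mu> u \<longleftrightarrow>
     P_solution a1 a2 q \<beta>1 \<beta>2 \<delta>1 \<delta>2 \<mu> u \<and> (\<exists>x\<in>II. u x \<noteq> 0)"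

definition P_eigenvalue ::
  "real \<Rightarrow> real \<Rightarrow> (real \<Rightarrow> real) \<Rightarrow> real \<Rightarrow> real \<Rightarrow> real \<Rightarrow> real \<Rightarrow> complex \<Rightarrow> bool"
where
  "P_eigenvalue a1 a2 q \<beta>1 \<beta>2 \<delta>1 \<delta>2 \<mu> \<longleftrightarrow> (\<exists>u. P_eigenfunction a1 a2 q \<beta>1 \<beta>2 \<delta>1 \<delta>2 \<mu> u)"

section \<open>The operator \<open>A\<close>\<close>

text \<open>
  \<open>dom_rep \<dots> F u\<close>: the function \<open>u\<close> is a representative of the first component of \<open>F\<close> with the
  properties required of the elements of \<open>D(A)\<close>. The derivatives up to order 3 are classical
  and locally absolutely continuous; the outermost derivative in \<open>Lu\<close> then exists almost
  everywhere only, which is recorded explicitly so that \<open>Lu \<in> L\<^sup>2(I)\<close> is meaningful.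
  The one-sided limits at \<open>-1\<close>, \<open>0\<close>, \<open>1\<close> of the derivatives up to order 3 need not be
  postulated: \<open>Lu\<close> and \<open>q u\<close> are square-integrable, \<open>q\<close> being bounded, so the fourth
  derivative is integrable on \<open>(-1,0)\<close> and \<open>(0,1)\<close>.
\<close>

definition dom_rep ::
  "real \<Rightarrow> real \<Rightarrow> (real \<Rightarrow> real) \<Rightarrow> real \<Rightarrow> real \<Rightarrow> real \<Rightarrow> real \<Rightarrow> Z \<Rightarrow> (real \<Rightarrow> complex) \<Rightarrow> bool"
where
  "dom_rep a1 a2 q \<beta>1 \<beta>2 \<delta>1 \<delta>2 F u \<longleftrightarrow>
     (case F of (f, h1, h2, h3, h4) \<Rightarrow>
        represents u f \<and>
        (\<forall>i<3. \<forall>x\<in>{-1<..<0} \<union> {0<..<1}. Dn i u differentiable (at x)) \<and>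
        (\<forall>i\<le>3. AC_loc {-1<..<0} (Dn i u) \<and> AC_loc {0<..<1} (Dn i u)) \<and>
        (AE x in lebesgue_on II. Dn 1 (au2 a1 a2 u) differentiable (at x)) \<and>
        sq_int (L a1 a2 q u) \<and>
        L1 u = 0 \<and> L2 \<beta>1 \<beta>2 u = 0 \<and> L3 u = 0 \<and> L4 u = 0 \<and>
        h1 = at_p1 u \<and> h2 = at_p1 (Dn 1 u) \<and>
        h3 = - of_real \<delta>1 * at_0m (Dn 1 u) \<and> h4 = - of_real \<delta>2 * at_0m u)"

definition dom_A ::
  "real \<Rightarrow> real \<Rightarrow> (real \<Rightarrow> real) \<Rightarrow> real \<Rightarrow> real \<Rightarrow> real \<Rightarrow> real \<Rightarrow> Z set"
where
  "dom_A a1 a2 q \<beta>1 \<beta>2 \<delta>1 \<delta>2 = {F. \<exists>u. dom_rep a1 a2 q \<beta>1 \<beta>2 \<delta>1 \<delta>2 F u}"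

text \<open>
  Two representatives as in \<open>dom_rep\<close> of the same class are continuous on \<open>(-1,0)\<close> and \<open>(0,1)\<close>,
  hence coincide there, so the value of \<open>op_A\<close> does not depend on the choice.
\<close>

definition op_A ::
  "real \<Rightarrow> real \<Rightarrow> (real \<Rightarrow> real) \<Rightarrow> real \<Rightarrow> real \<Rightarrow> real \<Rightarrow> real \<Rightarrow> Z \<Rightarrow> Z"
where
  "op_A a1 a2 q \<beta>1 \<beta>2 \<delta>1 \<delta>2 F =
     (let u = (SOME u. dom_rep a1 a2 q \<beta>1 \<beta>2 \<delta>1 \<delta>2 F u)
      in (abs_l2 (L a1 a2 q u),
          - at_p1 (Dn 3 u),
          - at_p1 (Dn 2 u),
          at_0p (Dn 2 u) - at_0m (Dn 2 u),
          at_0p (Dn 3 u) - at_0m (Dn 3 u)))"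

definition eigenelement :: "Z set \<Rightarrow> (Z \<Rightarrow> Z) \<Rightarrow> complex \<Rightarrow> Z \<Rightarrow> bool" where
  "eigenelement dm T \<mu> F \<longleftrightarrow> F \<in> dm \<and> F \<noteq> 0 \<and> T F = scale_Z \<mu> F"

definition eigenvalue :: "Z set \<Rightarrow> (Z \<Rightarrow> Z) \<Rightarrow> complex \<Rightarrow> bool" where
  "eigenvalue dm T \<mu> \<longleftrightarrow> (\<exists>F. eigenelement dm T \<mu> F)"

end

theory Submission
  imports Defs
begin

text \<open>
  The operator \<open>A\<close> is built so that its eigenvalue equation encodes Problem (P). The conditions
  \<open>L\<^sub>1, \<dots>, L\<^sub>4\<close> are part of its domain; the components \<open>h\<^sub>1, \<dots>, h\<^sub>4\<close> are boundary values of the first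
  component, and for them \<open>AF = \<mu>F\<close> says exactly \<open>L\<^sub>7 = L\<^sub>8 = L\<^sub>5 = L\<^sub>6 = 0\<close>
  (\<open>eigen_equation_iff\<close>). What remains is the comparison of two notions of solution of \<open>Lu = \<mu>u\<close>:
  a function that is four times differentiable at every point of \<open>I\<close>, with limits at \<open>0\<close>, and a
  class in \<open>L\<^sup>2\<close> with a representative whose third derivative is locally absolutely continuous
  and for which the equation holds almost everywhere.

  A classical solution is bounded, hence square-integrable; it and its first three derivatives are
  continuously differentiable inside \<open>I\<close>, hence locally absolutely continuous there. So it
  represents an element of \<open>D(A)\<close> (\<open>P_solution_dom_rep\<close>).

  Conversely, let \<open>u\<close> represent an eigenelement. Then \<open>u''''\<close> equals the continuous function
  \<open>(\<mu> - q) u / a\<close> almost everywhere, and the fundamental theorem of calculus for absolutely continuous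
  functions (\<open>abs_cont_on_fundamental_theorem\<close>) makes this true at every point inside \<open>I\<close>
  (\<open>AE_equation_imp_classical\<close>). As \<open>q\<close> is bounded and \<open>u\<close> is square-integrable, \<open>u''''\<close> is
  integrable, so \<open>u'''\<close>, and successively \<open>u''\<close>, \<open>u'\<close>, \<open>u\<close>, have one-sided limits at \<open>-1\<close>, \<open>0\<close>,
  \<open>1\<close> (\<open>classical_on_extends\<close>). Correcting the values of \<open>u\<close> at \<open>-1\<close> and \<open>1\<close> gives a classical
  solution of (P) in the same class (\<open>classical_on_endpoints\<close>).

  Two representatives of a class coincide inside \<open>I\<close> by continuity, and all boundary terms are
  limits from inside; thus nothing depends on the choice of the representative, and \<open>F \<noteq> 0\<close>
  corresponds to \<open>u \<noteq> 0\<close> (\<open>element_of_eq_0_iff\<close>).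
\<close>

section \<open>The fundamental theorem of calculus for absolutely continuous functions\<close>

lemma negligible_open_cover:
  fixes N :: "real set"
  assumes "negligible N" "e > 0"
  obtains U where "open U" "N \<subseteq> U" "U \<in> lmeasurable" "measure lebesgue U < e"
proof -
  have N: "N \<in> lmeasurable" "measure lebesgue N = 0"
    using assms(1) by (auto simp: negligible_iff_measure)
  then obtain U where U: "open U" "N \<subseteq> U" "U - N \<in> lmeasurable" "emeasure lebesgue (U - N) < ennreal e"
    using sets_lebesgue_outer_open[of N e] \<open>e > 0\<close> fmeasurableD by blast
  have UN: "U = (U - N) \<union> N" using U(2) by blast
  have lm: "U \<in> lmeasurable" 
    by (subst UN) (intro fmeasurable.Un U(3) N(1))
  have "measure lebesgue U \<le> measure lebesgue (U - N) + measure lebesgue N"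
    by (subst (1) UN) (rule measure_Un_le; use U(3) N(1) in auto)
  moreover have "measure lebesgue (U - N) < e"
    using U(3,4) \<open>e > 0\<close> by (simp add: emeasure_eq_measure2 ennreal_less_iff)
  ultimately show ?thesis using that U(1,2) lm N(2) by simp
qed

text \<open>
  The gauge integral gives a direct proof. Choose a gauge that is controlled by
  differentiability at the tags outside the exceptional null set \<open>N\<close> and that forces the intervals
  tagged in \<open>N\<close> into an open set of small measure. The former contribute a small error to the
  Riemann sum by the definition of the derivative; the latter have small total length, so absolute
  continuity bounds the total increment of \<open>h\<close> over them.
\<close>

lemma abs_cont_on_fundamental_theorem:
  fixes h g :: "real \<Rightarrow> complex"
  assumes ac: "abs_cont_on {c..d} h" and "c \<le> d" and N: "negligible N"
    and der: "\<And>x. x \<in> {c..d} - N \<Longrightarrow> (h has_vector_derivative g x) (at x within {c..d})"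
  shows "(g has_integral (h d - h c)) {c..d}"
proof -
  define g0 where "g0 x = (if x \<in> N then 0 else g x)" for x
  \<comment> \<open>the values of \<open>g\<close> on \<open>N\<close> are uncontrolled, so the Riemann sums are formed with \<open>0\<close> there\<close>
  have "(g0 has_integral (h d - h c)) {c..d}"
    unfolding has_integral_factor_content_real
  proof (intro allI impI)
    show "\<exists>\<gamma>. gauge \<gamma> \<and> (\<forall>p. p tagged_division_of {c..d} \<and> \<gamma> fine p \<longrightarrow>
       norm ((\<Sum>(x, K)\<in>p. measure lborel K *\<^sub>R g0 x) - (h d - h c)) \<le> e * measure lborel {c..d})"
      if "e > 0" for e
    proof (cases "c = d")
      case True
      have "gauge (\<lambda>x::real. UNIV :: real set)" by (simp add: gauge_def)
      moreover have "(\<Sum>(x, K)\<in>p. measure lborel K *\<^sub>R g0 x) = 0" if p: "p tagged_division_of {c..d}" for p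
        using sum_content_null[of c d p g0] p True by (simp add: box_real)
      ultimately show ?thesis using True by (auto intro!: exI[of _ "\<lambda>x. UNIV"])
    next
      case False
      \<comment> \<open>half of the permitted error for the tags in \<open>N\<close>, half for the others\<close>
      define \<epsilon> where "\<epsilon> = e * (d - c) / 2"
      have "c < d" using False \<open>c \<le> d\<close> by simp
      then have "\<epsilon> > 0" using \<open>e > 0\<close> by (simp add: \<epsilon>_def)
      then obtain \<delta> where "\<delta> > 0" and
        \<delta>: "\<And>D S. D division_of S \<Longrightarrow> S \<subseteq> {c..d} \<Longrightarrow> (\<Sum>k\<in>D. Sup k - Inf k) < \<delta> \<Longrightarrow>
          (\<Sum>k\<in>D. norm (h (Sup k) - h (Inf k))) < \<epsilon>"
        using ac unfolding abs_cont_on_def by meson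
      obtain U where U: "open U" "N \<subseteq> U" "U \<in> lmeasurable" "measure lebesgue U < \<delta>"
        using negligible_open_cover[OF N \<open>\<delta> > 0\<close>] by blast
      have "\<forall>x. \<exists>r>0. x \<in> {c..d} - N \<longrightarrow> (\<forall>y\<in>{c..d}. \<bar>y - x\<bar> < r \<longrightarrow>
          norm (h y - h x - (y - x) *\<^sub>R g x) \<le> e / 2 * \<bar>y - x\<bar>)"
      proof
        fix x
        show "\<exists>r>0. x \<in> {c..d} - N \<longrightarrow> (\<forall>y\<in>{c..d}. \<bar>y - x\<bar> < r \<longrightarrow>
          norm (h y - h x - (y - x) *\<^sub>R g x) \<le> e / 2 * \<bar>y - x\<bar>)"
        proof (cases "x \<in> {c..d} - N")
          case True
          from der[OF this] half_gt_zero[OF \<open>e > 0\<close>] show ?thesis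
            unfolding has_vector_derivative_def has_derivative_within_alt real_norm_def by blast
        qed (auto intro: exI[of _ 1])
      qed
      then obtain r where r: "\<And>x. r x > 0"
        "\<And>x y. x \<in> {c..d} - N \<Longrightarrow> y \<in> {c..d} \<Longrightarrow> \<bar>y - x\<bar> < r x \<Longrightarrow>
          norm (h y - h x - (y - x) *\<^sub>R g x) \<le> e / 2 * \<bar>y - x\<bar>"
        unfolding choice_iff by blast
      define \<gamma> where "\<gamma> x = (if x \<in> N then U else ball x (r x))" for x
      have "gauge \<gamma>"
        using U(1,2) r(1) by (auto simp: gauge_def \<gamma>_def)
      moreover have "norm ((\<Sum>(x, K)\<in>p. measure lborel K *\<^sub>R g0 x) - (h d - h c)) \<le> e * measure lborel {c..d}"
        if p: "p tagged_division_of {c..d}" and fine: "\<gamma> fine p" for p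
      proof -
        define err where "err = (\<lambda>(x, K). measure lborel K *\<^sub>R g0 x - (h (Sup K) - h (Inf K)))"
        have fin: "finite p" using p by blast
        define p1 where "p1 = {z \<in> p. fst z \<in> N}"
        define p2 where "p2 = {z \<in> p. fst z \<notin> N}"
        have split: "p = p1 \<union> p2" "p1 \<inter> p2 = {}" "finite p1" "finite p2"
          using fin by (auto simp: p1_def p2_def)
        have "(\<Sum>z\<in>p. err z) = (\<Sum>(x, K)\<in>p. measure lborel K *\<^sub>R g0 x) - (h d - h c)"
          using additive_tagged_division_1[OF \<open>c \<le> d\<close> p, of h]
          by (simp add: err_def case_prod_unfold sum_subtractf)
        moreover have "norm (\<Sum>z\<in>p. err z) \<le> (\<Sum>z\<in>p1. norm (err z)) + (\<Sum>z\<in>p2. norm (err z))"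
          unfolding split(1)
          using norm_sum[of err "p1 \<union> p2"] split by (simp add: sum.union_disjoint)
        moreover have "(\<Sum>z\<in>p2. norm (err z)) \<le> \<epsilon>"
        proof -
          have "(\<Sum>z\<in>p2. norm (err z)) \<le> (\<Sum>(x,K)\<in>p2. e / 2 * measure lborel K)"
          proof (rule sum_mono, clarify)
            fix x K assume xK: "(x, K) \<in> p2"
            then have inp: "(x, K) \<in> p" "x \<notin> N" by (auto simp: p2_def)
            have K: "x \<in> K" "K \<subseteq> {c..d}" "K \<subseteq> ball x (r x)"
              using tagged_division_ofD(2,3)[OF p inp(1)] fineD[OF fine inp(1)] inp(2)
              by (auto simp: \<gamma>_def)
            obtain u v where uv: "K = {u..v}" "u \<le> x" "x \<le> v"
              using tagged_division_ofD(4)[OF p inp(1)] K(1) by auto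
            have "u \<in> K" "v \<in> K" using uv by auto
            then have "u \<in> {c..d}" "v \<in> {c..d}" "\<bar>u - x\<bar> < r x" "\<bar>v - x\<bar> < r x"
              using K by (auto simp: dist_real_def abs_minus_commute subset_iff)
            moreover have "x \<in> {c..d} - N" using K inp by auto
            ultimately have
              "norm (h u - h x - (u - x) *\<^sub>R g x) \<le> e / 2 * \<bar>u - x\<bar>"
              "norm (h v - h x - (v - x) *\<^sub>R g x) \<le> e / 2 * \<bar>v - x\<bar>"
              using r(2) by blast+
            moreover have "err (x, K) = (h u - h x - (u - x) *\<^sub>R g x) - (h v - h x - (v - x) *\<^sub>R g x)"
              using uv inp by (simp add: err_def g0_def algebra_simps scaleR_diff_left)
            then have "norm (err (x, K)) \<le> norm (h u - h x - (u - x) *\<^sub>R g x)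
                + norm (h v - h x - (v - x) *\<^sub>R g x)"
              using norm_triangle_ineq4 by metis
            ultimately have "norm (err (x, K)) \<le> e / 2 * \<bar>u - x\<bar> + e / 2 * \<bar>v - x\<bar>" by linarith
            also have "\<dots> = e / 2 * measure lborel K"
              using uv by (simp add: field_simps)
            finally show "norm (err (x, K)) \<le> e / 2 * measure lborel K" .
          qed
          also have "\<dots> \<le> (\<Sum>(x,K)\<in>p. e / 2 * measure lborel K)"
            using \<open>e > 0\<close> fin by (intro sum_mono2) (auto simp: p2_def)
          also have "\<dots> = e / 2 * measure lborel {c..d}"
            using additive_content_tagged_division[of p c d] p
            by (simp only: case_prod_unfold sum_distrib_left[symmetric] box_real)
          finally show ?thesis using \<open>c < d\<close> by (simp add: \<epsilon>_def)
        qed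
        moreover have "(\<Sum>z\<in>p1. norm (err z)) < \<epsilon>"
        proof -
          have tp: "p1 tagged_partial_division_of {c..d}"
            using p tagged_partial_division_subset[of p "{c..d}" p1]
            by (auto simp: tagged_division_of_def p1_def)
          have dv: "snd ` p1 division_of \<Union>(snd ` p1)"
            by (rule partial_division_of_tagged_division[OF tp])
          have td: "p1 tagged_division_of \<Union>(snd ` p1)"
            by (rule tagged_partial_division_of_Union_self[OF tp])
          have sub: "\<Union>(snd ` p1) \<subseteq> {c..d}"
            using tagged_partial_division_ofD(3)[OF tp] by fastforce
          have subU: "\<Union>(snd ` p1) \<subseteq> U"
            using fineD[OF fine] by (fastforce simp: p1_def \<gamma>_def)
          have "(\<Sum>k\<in>snd ` p1. Sup k - Inf k) = (\<Sum>k\<in>snd ` p1. measure lebesgue k)"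
          proof (rule sum.cong)
            fix k assume "k \<in> snd ` p1"
            then obtain u v where "k = cbox u v" "k \<noteq> {}" using division_ofD(3,4)[OF dv] by meson
            then show "Sup k - Inf k = measure lebesgue k" by auto
          qed simp
          also have "\<dots> = measure lebesgue (\<Union>(snd ` p1))"
            by (rule content_division[OF dv])
          also have "\<dots> \<le> measure lebesgue U"
            using lmeasurable_division[OF dv] subU U(3)
            by (intro measure_mono_fmeasurable) auto
          also have "\<dots> < \<delta>" by (rule U(4))
          finally have small: "(\<Sum>k\<in>snd ` p1. norm (h (Sup k) - h (Inf k))) < \<epsilon>"
            by (rule \<delta>[OF dv sub])
          \<comment> \<open>the guard for \<open>{}\<close>, where \<open>Sup\<close> and \<open>Inf\<close> have unspecified values, makes degenerate boxes count \<open>0\<close>\<close>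
          define var where "var K = (if K = {} then 0 else norm (h (Sup K) - h (Inf K)))" for K
          have "(\<Sum>z\<in>p1. norm (err z)) = (\<Sum>(x,K)\<in>p1. var K)"
          proof (rule sum.cong; clarify?)
            fix x K assume xK: "(x, K) \<in> p1"
            then have "K \<noteq> {}" using tagged_partial_division_ofD(2)[OF tp] by blast
            with xK show "norm (err (x, K)) = var K"
              by (simp add: err_def p1_def g0_def var_def norm_minus_commute)
          qed
          also have "\<dots> = (\<Sum>k\<in>snd ` p1. var k)"
            by (rule sum.over_tagged_division_lemma[OF td])
               (auto simp: box_real not_less var_def le_less)
          also have "\<dots> = (\<Sum>k\<in>snd ` p1. norm (h (Sup k) - h (Inf k)))"
            using division_ofD(3)[OF dv] by (intro sum.cong) (auto simp: var_def)
          finally show ?thesis using small by simp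
        qed
        ultimately have "norm ((\<Sum>(x, K)\<in>p. measure lborel K *\<^sub>R g0 x) - (h d - h c)) \<le> \<epsilon> + \<epsilon>"
          by simp
        then show ?thesis using \<open>c < d\<close> by (simp add: \<epsilon>_def)
      qed
      ultimately show ?thesis by (intro exI[of _ \<gamma>] conjI allI impI) auto
    qed
  qed
  then show ?thesis
    by (rule has_integral_spike[OF N, rotated]) (auto simp: g0_def)
qed

text \<open>
  This upgrades an equation for the derivative from almost everywhere to everywhere: \<open>h\<close> is an
  indefinite integral of \<open>g\<close>, and an indefinite integral of a continuous function is differentiable
  at every point.
\<close>

lemma abs_cont_on_derivative_everywhere:
  fixes h g :: "real \<Rightarrow> complex"
  assumes ac: "AC_loc {p<..<r} h" and N: "negligible N"
    and der: "\<And>x. x \<in> {p<..<r} - N \<Longrightarrow> (h has_vector_derivative g x) (at x)"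
    and cont: "continuous_on {p<..<r} g" and x: "x \<in> {p<..<r}"
  shows "(h has_vector_derivative g x) (at x)"
proof -
  define c d where "c = (p + x) / 2" and "d = (x + r) / 2"
  have cd: "p < c" "c < x" "x < d" "d < r" using x by (auto simp: c_def d_def field_simps)
  have sub: "{c..d} \<subseteq> {p<..<r}" using cd by auto
  have "h y = h c + integral {c..y} g" if y: "y \<in> {c..d}" for y
  proof -
    have "(g has_integral (h y - h c)) {c..y}"
    proof (rule abs_cont_on_fundamental_theorem[OF _ _ N])
      show "abs_cont_on {c..y} h"
      proof -
        have "{c..y} \<subseteq> {p<..<r}" using y cd by auto
        then show ?thesis using ac by (simp add: AC_loc_def)
      qed
      show "(h has_vector_derivative g z) (at z within {c..y})" if "z \<in> {c..y} - N" for z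
        using that y cd by (intro has_vector_derivative_at_within[OF der]) auto
    qed (use y in auto)
    then show ?thesis by (simp add: integral_unique)
  qed
  note repr = this
  have "(h has_vector_derivative g x) (at x within {c..d})"
  proof (rule has_vector_derivative_transform[OF _ repr])
    show "((\<lambda>y. h c + integral {c..y} g) has_vector_derivative g x) (at x within {c..d})"
      using cd integral_has_vector_derivative[OF continuous_on_subset[OF cont sub], of x]
      by (auto intro!: derivative_eq_intros)
  qed (use cd in auto)
  then show ?thesis
    using cd by (simp add: at_within_Icc_at)
qed

text \<open>
  On a compact subinterval the derivative is bounded, so \<open>f\<close> is Lipschitz there.
\<close>

lemma AC_loc_continuous_derivative:
  fixes f g :: "real \<Rightarrow> complex"
  assumes der: "\<And>x. x \<in> {p<..<r} \<Longrightarrow> (f has_vector_derivative g x) (at x)"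
    and cont: "continuous_on {p<..<r} g"
  shows "AC_loc {p<..<r} f"
  unfolding AC_loc_def
proof (intro allI impI)
  fix c d assume cd: "{c..d} \<subseteq> {p<..<r}"
  have "compact (g ` {c..d})"
    by (intro compact_continuous_image continuous_on_subset[OF cont cd]) auto
  then obtain B where "B > 0" and B: "\<And>x. x \<in> {c..d} \<Longrightarrow> norm (g x) \<le> B"
    using compact_imp_bounded[of "g ` {c..d}"] unfolding bounded_pos by blast
  have lip: "norm (f v - f u) \<le> B * (v - u)" if "u \<in> {c..d}" "v \<in> {c..d}" "u \<le> v" for u v
  proof -
    have "norm (f v - f u) \<le> B * norm (v - u)"
    proof (rule differentiable_bound[OF convex_real_interval(5)[of c d]])
      fix x assume "x \<in> {c..d}"
      then show "(f has_derivative (\<lambda>h. h *\<^sub>R g x)) (at x within {c..d})"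
        using der cd has_vector_derivative_at_within
        unfolding has_vector_derivative_def[symmetric] by blast
      show "onorm (\<lambda>h. h *\<^sub>R g x) \<le> B"
        using B[OF \<open>x \<in> {c..d}\<close>] by (intro onorm_le) (simp add: mult.commute[of B] mult_left_mono)
    qed (use that in auto)
    then show ?thesis using that by simp
  qed
  show "abs_cont_on {c..d} f"
    unfolding abs_cont_on_def
  proof (intro allI impI)
    fix \<epsilon> :: real assume "\<epsilon> > 0"
    have "(\<Sum>k\<in>D. norm (f (Sup k) - f (Inf k))) < \<epsilon>"
      if D: "D division_of S" "S \<subseteq> {c..d}" and small: "(\<Sum>k\<in>D. Sup k - Inf k) < \<epsilon> / B" for D S
    proof -
      have "(\<Sum>k\<in>D. norm (f (Sup k) - f (Inf k))) \<le> (\<Sum>k\<in>D. B * (Sup k - Inf k))"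
      proof (rule sum_mono)
        fix k assume k: "k \<in> D"
        then obtain u v where "k = {u..v}" "u \<le> v"
          using division_ofD(3,4)[OF D(1) k] by auto
        moreover have "k \<subseteq> {c..d}" using division_ofD(2)[OF D(1) k] D(2) by auto
        ultimately show "norm (f (Sup k) - f (Inf k)) \<le> B * (Sup k - Inf k)"
          by (auto intro!: lip)
      qed
      also have "\<dots> = B * (\<Sum>k\<in>D. Sup k - Inf k)" by (simp add: sum_distrib_left)
      also have "\<dots> < \<epsilon>" using small \<open>B > 0\<close> by (simp add: field_simps)
      finally show ?thesis .
    qed
    moreover have "\<epsilon> / B > 0" using \<open>\<epsilon> > 0\<close> \<open>B > 0\<close> by simp
    ultimately show "\<exists>\<delta>>0. \<forall>D S. D division_of S \<and> S \<subseteq> {c..d} \<and> (\<Sum>k\<in>D. Sup k - Inf k) < \<delta>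
        \<longrightarrow> (\<Sum>k\<in>D. norm (f (Sup k) - f (Inf k))) < \<epsilon>"
      by (intro exI[of _ "\<epsilon> / B"] conjI allI impI) auto
  qed
qed

section \<open>Continuous extension to the end points of an interval\<close>

definition extends_to_Icc :: "real \<Rightarrow> real \<Rightarrow> (real \<Rightarrow> complex) \<Rightarrow> bool" where
  "extends_to_Icc p r f \<longleftrightarrow> (\<exists>W. continuous_on {p..r} W \<and> (\<forall>x\<in>{p<..<r}. W x = f x))"

lemma eventually_inside_Ioo:
  fixes p r :: real
  assumes "p < r"
  shows "eventually (\<lambda>x. x \<in> {p<..<r}) (at_right p)" "eventually (\<lambda>x. x \<in> {p<..<r}) (at_left r)"
  using assms eventually_at_right_real[of p r] eventually_at_left_real[of p r] by auto

lemma extends_to_Icc_iff_limits: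
  assumes "p < r" and "continuous_on {p<..<r} f"
  shows "extends_to_Icc p r f \<longleftrightarrow> (\<exists>l. (f \<longlongrightarrow> l) (at_right p)) \<and> (\<exists>l. (f \<longlongrightarrow> l) (at_left r))"
proof
  assume "extends_to_Icc p r f"
  then obtain W where W: "continuous_on {p..r} W" "\<forall>x\<in>{p<..<r}. W x = f x"
    by (auto simp: extends_to_Icc_def)
  have "(f \<longlongrightarrow> W p) (at_right p)"
    by (rule Lim_transform_eventually[OF continuous_on_Icc_at_rightD[OF W(1) \<open>p < r\<close>]])
       (use eventually_inside_Ioo(1)[OF \<open>p < r\<close>] in \<open>rule eventually_mono\<close>, use W(2) in auto)
  moreover have "(f \<longlongrightarrow> W r) (at_left r)"
    by (rule Lim_transform_eventually[OF continuous_on_Icc_at_leftD[OF W(1) \<open>p < r\<close>]])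
       (use eventually_inside_Ioo(2)[OF \<open>p < r\<close>] in \<open>rule eventually_mono\<close>, use W(2) in auto)
  ultimately show "(\<exists>l. (f \<longlongrightarrow> l) (at_right p)) \<and> (\<exists>l. (f \<longlongrightarrow> l) (at_left r))" by blast
next
  assume "(\<exists>l. (f \<longlongrightarrow> l) (at_right p)) \<and> (\<exists>l. (f \<longlongrightarrow> l) (at_left r))"
  then obtain l m where lm: "(f \<longlongrightarrow> l) (at_right p)" "(f \<longlongrightarrow> m) (at_left r)" by blast
  define W where "W x = (if x = p then l else if x = r then m else f x)" for x
  have "continuous_on {p..r} W"
  proof (rule continuous_on_IccI)
    show "(W \<longlongrightarrow> W p) (at_right p)"
      by (rule Lim_transform_eventually[of f])
         (use lm in \<open>simp add: W_def\<close>, use eventually_inside_Ioo(1)[OF \<open>p < r\<close>] in \<open>rule eventually_mono\<close>,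
          auto simp: W_def)
    show "(W \<longlongrightarrow> W r) (at_left r)"
      by (rule Lim_transform_eventually[of f])
         (use lm \<open>p < r\<close> in \<open>simp add: W_def\<close>,
          use eventually_inside_Ioo(2)[OF \<open>p < r\<close>] in \<open>rule eventually_mono\<close>, auto simp: W_def)
    fix x assume x: "p < x" "x < r"
    then have "(f \<longlongrightarrow> f x) (at x)"
      using assms(2) by (auto simp: continuous_on_eq_continuous_at isCont_def)
    moreover have "eventually (\<lambda>y. f y = W y) (at x)"
      using x by (intro eventually_at_in_open'[of "{p<..<r}", THEN eventually_mono]) (auto simp: W_def)
    ultimately show "(W \<longlongrightarrow> W x) (at x)"
      using x Lim_transform_eventually[of f "f x" "at x" W] by (simp add: W_def)
  qed fact
  then show "extends_to_Icc p r f"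
    unfolding extends_to_Icc_def by (intro exI[of _ W]) (auto simp: W_def)
qed

text \<open>
  By the fundamental theorem \<open>W\<close> is an indefinite integral of \<open>G\<close> on the whole closed interval, so
  differentiability reaches the end points.
\<close>

lemma derivative_on_closure:
  fixes W G :: "real \<Rightarrow> complex"
  assumes "continuous_on {p..r} W" "continuous_on {p..r} G"
    and der: "\<And>x. x \<in> {p<..<r} \<Longrightarrow> (W has_vector_derivative G x) (at x)"
    and x: "x \<in> {p..r}"
  shows "(W has_vector_derivative G x) (at x within {p..r})"
proof (rule has_vector_derivative_transform[OF x])
  show "W y = W p + integral {p..y} G" if y: "y \<in> {p..r}" for y
  proof -
    have "(G has_integral (W y - W p)) {p..y}"
    proof (rule fundamental_theorem_of_calculus_interior)
      show "continuous_on {p..y} W"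
        using y by (intro continuous_on_subset[OF assms(1)]) auto
    qed (use y der in auto)
    then show ?thesis by (simp add: integral_unique)
  qed
  show "((\<lambda>y. W p + integral {p..y} G) has_vector_derivative G x) (at x within {p..r})"
    using integral_has_vector_derivative[OF assms(2) x]
    by (auto intro!: derivative_eq_intros)
qed

text \<open>
  On the open interval \<open>f\<close> differs by a constant from \<open>x \<mapsto> \<integral>\<^sub>p\<^sup>x g\<close>, which is continuous on the
  closed one. This is where the one-sided boundary values of the elements of \<open>D(A)\<close> come from.
\<close>

lemma integrable_derivative_extends:
  fixes f g :: "real \<Rightarrow> complex"
  assumes "p < r" and der: "\<And>x. x \<in> {p<..<r} \<Longrightarrow> (f has_vector_derivative g x) (at x)"
    and int: "g integrable_on {p..r}"
  shows "extends_to_Icc p r f"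
proof -
  let ?I = "\<lambda>x. integral {p..x} g"
  define c where "c = (p + r) / 2"
  have c: "c \<in> {p<..<r}" using \<open>p < r\<close> by (auto simp: c_def)
  have diff: "f t - f s = ?I t - ?I s" if "s \<in> {p<..<r}" "t \<in> {p<..<r}" "s \<le> t" for s t
  proof -
    have "(g has_integral (f t - f s)) {s..t}"
    proof (rule fundamental_theorem_of_calculus)
      show "(f has_vector_derivative g x) (at x within {s..t})" if "x \<in> {s..t}" for x
        by (rule has_vector_derivative_at_within[OF der])
           (use that \<open>s \<in> {p<..<r}\<close> \<open>t \<in> {p<..<r}\<close> in auto)
    qed fact
    moreover have "?I s + integral {s..t} g = ?I t"
      using that by (intro Henstock_Kurzweil_Integration.integral_combine integrable_on_subinterval[OF int]) auto
    ultimately show ?thesis by (simp add: integral_unique algebra_simps)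
  qed
  have "f x = f c - ?I c + ?I x" if "x \<in> {p<..<r}" for x
    using diff[of x c] diff[of c x] that c by (cases "x \<le> c") (auto simp: algebra_simps)
  moreover have "continuous_on {p..r} (\<lambda>x. f c - ?I c + ?I x)"
    by (intro continuous_intros indefinite_integral_continuous_1 int)
  ultimately show ?thesis unfolding extends_to_Icc_def by fastforce
qed

lemma extends_to_Icc_integrable:
  assumes "extends_to_Icc p r f"
  shows "f integrable_on {p..r}"
proof -
  obtain W where W: "continuous_on {p..r} W" "\<forall>x\<in>{p<..<r}. W x = f x"
    using assms by (auto simp: extends_to_Icc_def)
  show ?thesis
    by (rule integrable_spike_finite[of "{p, r}" _ _ W])
       (use W in \<open>auto intro: integrable_continuous_real\<close>)
qed

lemma extends_to_Icc_bounded: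
  assumes "extends_to_Icc p r f"
  shows "bounded (f ` {p<..<r})"
proof -
  obtain W where W: "continuous_on {p..r} W" "\<forall>x\<in>{p<..<r}. W x = f x"
    using assms by (auto simp: extends_to_Icc_def)
  have "bounded (W ` {p..r})"
    by (intro compact_imp_bounded compact_continuous_image W(1)) auto
  then show ?thesis
  proof (rule bounded_subset)
    have "f ` {p<..<r} = W ` {p<..<r}" using W(2) by (intro image_cong) auto
    then show "f ` {p<..<r} \<subseteq> W ` {p..r}" by (auto intro!: imageI)
  qed
qed

section \<open>Derivatives within I\<close>

abbreviation inner_II :: "real set" where
  "inner_II \<equiv> {-1<..<0} \<union> {0<..<1}"

text \<open>
  The two components \<open>(-1,0)\<close> and \<open>(0,1)\<close> are always treated alike; quantifying over the end
  points \<open>p\<close>, \<open>r\<close> lets one argument serve both.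
\<close>

definition half :: "real \<Rightarrow> real \<Rightarrow> bool" where
  "half p r \<longleftrightarrow> p = -1 \<and> r = 0 \<or> p = 0 \<and> r = 1"

lemma half_less: "half p r \<Longrightarrow> p < r"
  by (auto simp: half_def)

lemma half_subset: "half p r \<Longrightarrow> {p<..<r} \<subseteq> inner_II" "half p r \<Longrightarrow> {p<..<r} \<subseteq> II"
  by (auto simp: half_def II_def)

lemma open_inner_II: "open inner_II"
  by (intro open_Un) auto

lemma inner_II_half: "x \<in> inner_II \<Longrightarrow> \<exists>p r. half p r \<and> x \<in> {p<..<r}"
  by (auto simp: half_def)

lemma inner_II_subset: "inner_II \<subseteq> II"
  by (auto simp: II_def)

text \<open>
  The point \<open>0\<close> is missing from \<open>II\<close>, so near each of its points \<open>II\<close> looks like one of the two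
  closed halves. Derivatives within \<open>II\<close> can thus be computed on an interval, where they are unique.
\<close>

lemma II_cases:
  assumes "x \<in> II"
  obtains p r where "half p r" "x \<in> {p..r}" "at x within II = at x within {p..r}"
proof (cases "x < 0")
  case True
  have "at x within II = at x within {-1..0}"
    using True assms by (intro at_within_nhd[where S = "{..<0}"]) (auto simp: II_def)
  then show ?thesis using that[of "-1" 0] True assms by (auto simp: half_def II_def)
next
  case False
  then have "at x within II = at x within {0..1}"
    using assms by (intro at_within_nhd[where S = "{0<..}"]) (auto simp: II_def)
  then show ?thesis using that[of 0 1] False assms by (auto simp: half_def II_def)
qed

lemma at_within_II_inner: "x \<in> inner_II \<Longrightarrow> at x within II = at x"
  by (rule at_within_open_subset[of x inner_II]) (auto simp: II_def)

lemma D_eqI: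
  assumes "x \<in> II" "(u has_vector_derivative d) (at x within II)"
  shows "D u x = d"
proof -
  obtain p r where "half p r" "x \<in> {p..r}" "at x within II = at x within {p..r}"
    using II_cases[OF assms(1)] .
  then show ?thesis
    using assms(2) vector_derivative_within_cbox[of p r x u d] half_less
    by (simp add: D_def)
qed

lemma differentiable_imp_D:
  "u differentiable (at x within II) \<Longrightarrow> (u has_vector_derivative D u x) (at x within II)"
  by (simp add: D_def vector_derivative_works[symmetric])

lemma Dn_simps: "Dn 0 u = u" "Dn (Suc i) u = D (Dn i u)" "Dn 1 u = D u" "Dn 2 u = D (D u)" "Dn 3 u = D (D (D u))"
  by (simp_all add: numeral_eq_Suc)

lemma D_inner_cong:
  assumes "\<And>x. x \<in> inner_II \<Longrightarrow> u x = w x" "x \<in> inner_II"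
  shows "D u x = D w x"
  unfolding D_def at_within_II_inner[OF assms(2)]
proof (rule vector_derivative_cong_eq)
  show "\<forall>\<^sub>F y in nhds x. y \<in> UNIV \<longrightarrow> u y = w y"
    by (rule eventually_mono[OF eventually_nhds_in_open[of inner_II x]]) (use assms in auto)
qed (use assms in auto)

lemma Dn_inner_cong:
  assumes "\<And>x. x \<in> inner_II \<Longrightarrow> u x = w x" "x \<in> inner_II"
  shows "Dn i u x = Dn i w x"
  using assms(2)
proof (induction i arbitrary: x)
  case 0
  then show ?case using assms(1) by simp
next
  case (Suc i)
  show ?case unfolding Dn_simps by (rule D_inner_cong[OF Suc.IH Suc.prems])
qed

lemma coeff_a_pos: "a1 > 0 \<Longrightarrow> a2 > 0 \<Longrightarrow> coeff_a a1 a2 x > 0"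
  by (simp add: coeff_a_def)

lemma coeff_a_half: "half p r \<Longrightarrow> x \<in> {p<..<r} \<Longrightarrow> coeff_a a1 a2 x = coeff_a a1 a2 p"
  by (auto simp: half_def coeff_a_def)

text \<open>
  The coefficient is constant near every point of \<open>I\<close> and passes through the derivative.
\<close>

lemma coeff_mult_derivative:
  fixes f :: "real \<Rightarrow> complex"
  assumes "x \<in> II" "(f has_vector_derivative d) (at x within II)"
  shows "((\<lambda>y. of_real (coeff_a a1 a2 y) * f y) has_vector_derivative
           of_real (coeff_a a1 a2 x) * d) (at x within II)"
proof (rule has_vector_derivative_transform_within)
  show "((\<lambda>y. of_real (coeff_a a1 a2 x) * f y) has_vector_derivative
           of_real (coeff_a a1 a2 x) * d) (at x within II)"
    by (rule has_vector_derivative_mult_right[OF assms(2)])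
  show "0 < \<bar>x\<bar>" "x \<in> II" using assms(1) by (auto simp: II_def)
qed (auto simp: dist_real_def coeff_a_def)

lemma coeff_mult_derivative_iff:
  fixes f :: "real \<Rightarrow> complex"
  assumes "a1 > 0" "a2 > 0" "x \<in> II"
  shows "((\<lambda>y. of_real (coeff_a a1 a2 y) * f y) has_vector_derivative d) (at x within II)
     \<longleftrightarrow> (f has_vector_derivative d / of_real (coeff_a a1 a2 x)) (at x within II)"
    (is "?l \<longleftrightarrow> ?r")
proof
  assume ?l
  have inv: "of_real (coeff_a (1/a1) (1/a2) y) * (of_real (coeff_a a1 a2 y) * z) = (z :: complex)" for y z
    using assms(1,2) by (simp add: coeff_a_def power_divide)
  have "of_real (coeff_a (1/a1) (1/a2) x) * d = d / of_real (coeff_a a1 a2 x)"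
    by (simp add: coeff_a_def power_divide)
  then show ?r
    using coeff_mult_derivative[OF assms(3) \<open>?l\<close>, of "1/a1" "1/a2"] by (simp only: inv)
next
  assume ?r
  then show ?l
    using coeff_mult_derivative[OF assms(3) \<open>?r\<close>, of a1 a2] coeff_a_pos[OF assms(1,2), of x] by simp
qed

section \<open>The differential equation as a first-order chain\<close>

text \<open>
  The value that \<open>Lu = \<mu>u\<close> prescribes for the fourth derivative of \<open>u\<close>.
\<close>

definition rhs4 :: "real \<Rightarrow> real \<Rightarrow> (real \<Rightarrow> real) \<Rightarrow> complex \<Rightarrow> (real \<Rightarrow> complex) \<Rightarrow> real \<Rightarrow> complex" where
  "rhs4 a1 a2 q \<mu> u x = (\<mu> - of_real (q x)) * u x / of_real (coeff_a a1 a2 x)"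

text \<open>
  The equation in the form used throughout: the chain \<open>u, u', u'', u'''\<close> of derivatives, closed by
  the equation solved for the fourth one. Taking \<open>S = II\<close> gives the classical solutions on \<open>I\<close>
  (\<open>classical_on_II_iff\<close>). With \<open>S = inner_II\<close> nothing is said about the points \<open>-1\<close> and \<open>1\<close>, where
  a representative of an element of \<open>L\<^sup>2\<close> may take arbitrary values.
\<close>

definition classical_on ::
  "real \<Rightarrow> real \<Rightarrow> (real \<Rightarrow> real) \<Rightarrow> complex \<Rightarrow> real set \<Rightarrow> (real \<Rightarrow> complex) \<Rightarrow> bool" where
  "classical_on a1 a2 q \<mu> S u \<longleftrightarrow>
     (\<forall>x\<in>S. (\<forall>i<3. (Dn i u has_vector_derivative Dn (Suc i) u x) (at x within II)) \<and>
             (Dn 3 u has_vector_derivative rhs4 a1 a2 q \<mu> u x) (at x within II))"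

lemma all_less_3: "(\<forall>i<3::nat. P i) \<longleftrightarrow> P 0 \<and> P 1 \<and> P 2"
  by (auto simp: numeral_eq_Suc less_Suc_eq)

lemma D_au2:
  assumes "x \<in> II" "(Dn 2 u has_vector_derivative Dn 3 u x) (at x within II)"
  shows "(au2 a1 a2 u has_vector_derivative of_real (coeff_a a1 a2 x) * Dn 3 u x) (at x within II)"
    and "D (au2 a1 a2 u) x = of_real (coeff_a a1 a2 x) * Dn 3 u x"
proof -
  show "(au2 a1 a2 u has_vector_derivative of_real (coeff_a a1 a2 x) * Dn 3 u x) (at x within II)"
    using coeff_mult_derivative[OF assms, of a1 a2] unfolding au2_def .
  then show "D (au2 a1 a2 u) x = of_real (coeff_a a1 a2 x) * Dn 3 u x"
    by (rule D_eqI[OF assms(1)])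
qed

text \<open>
  As \<open>a\<close> is locally constant, \<open>(a u'')'\<close> equals \<open>a u'''\<close> near \<open>x\<close>, so differentiating it amounts
  to differentiating \<open>u'''\<close>. Both admissible sets \<open>S\<close> are relatively open in \<open>II\<close>, which is what
  makes the equality hold near \<open>x\<close>.
\<close>

lemma D_au2_derivative_iff:
  assumes "a1 > 0" "a2 > 0" and S: "S = II \<or> S = inner_II"
    and der: "\<And>x. x \<in> S \<Longrightarrow> (Dn 2 u has_vector_derivative Dn 3 u x) (at x within II)"
    and x: "x \<in> S"
  shows "(D (au2 a1 a2 u) has_vector_derivative d) (at x within II) \<longleftrightarrow>
         (Dn 3 u has_vector_derivative d / of_real (coeff_a a1 a2 x)) (at x within II)"
proof -
  have SI: "S \<subseteq> II" using S inner_II_subset by auto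
  have "(D (au2 a1 a2 u) has_vector_derivative d) (at x within II) \<longleftrightarrow>
     ((\<lambda>y. of_real (coeff_a a1 a2 y) * Dn 3 u y) has_vector_derivative d) (at x within II)"
  proof (rule has_vector_derivative_cong_ev)
    have "\<forall>\<^sub>F y in nhds x. y \<in> II \<longrightarrow> y \<in> S"
    proof (cases "S = II")
      case False
      then have "S = inner_II" using S by simp
      then have "\<forall>\<^sub>F y in nhds x. y \<in> S"
        using eventually_nhds_in_open[OF open_inner_II, of x] x by blast
      then show ?thesis by (rule eventually_mono) simp
    qed simp
    then show "\<forall>\<^sub>F y in nhds x. y \<in> II \<longrightarrow> D (au2 a1 a2 u) y = of_real (coeff_a a1 a2 y) * Dn 3 u y"
      by (rule eventually_mono) (use D_au2(2)[OF _ der] in blast)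
    show "D (au2 a1 a2 u) x = of_real (coeff_a a1 a2 x) * Dn 3 u x"
      using D_au2(2)[OF _ der] x SI by blast
  qed
  also have "\<dots> \<longleftrightarrow> (Dn 3 u has_vector_derivative d / of_real (coeff_a a1 a2 x)) (at x within II)"
    using x SI by (intro coeff_mult_derivative_iff assms(1,2)) auto
  finally show ?thesis .
qed

lemma classical_on_II_iff:
  assumes a: "a1 > 0" "a2 > 0"
  shows "classical_on a1 a2 q \<mu> II u \<longleftrightarrow>
     (\<forall>x\<in>II. (\<forall>i<2. Dn i u differentiable (at x within II) \<and>
                     Dn i (au2 a1 a2 u) differentiable (at x within II))) \<and>
     (\<forall>x\<in>II. L a1 a2 q u x = \<mu> * u x)" (is "?l \<longleftrightarrow> ?d \<and> ?e")
proof
  assume l: ?l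
  have d: "(Dn i u has_vector_derivative Dn (Suc i) u x) (at x within II)" if "x \<in> II" "i < 3" for x i
    using l that unfolding classical_on_def by blast
  have d2: "(Dn 2 u has_vector_derivative Dn 3 u x) (at x within II)" if "x \<in> II" for x
    using d[OF that, of 2] by (simp add: numeral_eq_Suc)
  have d3: "(D (au2 a1 a2 u) has_vector_derivative (\<mu> - of_real (q x)) * u x) (at x within II)"
    if "x \<in> II" for x
    using D_au2_derivative_iff[OF a disjI1[OF refl] d2 that] l that
    by (simp add: classical_on_def rhs4_def)
  show "?d \<and> ?e"
  proof (intro conjI ballI allI impI)
    fix x and i :: nat assume x: "x \<in> II" and i: "i < 2"
    show "Dn i u differentiable (at x within II)"
      using differentiableI_vector[OF d[OF x, of i]] i by simp
    show "Dn i (au2 a1 a2 u) differentiable (at x within II)"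
      using i differentiableI_vector[OF D_au2(1)[OF x d2[OF x]]] differentiableI_vector[OF d3[OF x]]
      by (auto simp: less_2_cases_iff)
  next
    fix x assume x: "x \<in> II"
    show "L a1 a2 q u x = \<mu> * u x"
      using D_eqI[OF x d3[OF x]] by (simp add: L_def Dn_simps algebra_simps)
  qed
next
  assume r: "?d \<and> ?e"
  then have da: "Dn i (au2 a1 a2 u) differentiable (at x within II)" if "x \<in> II" "i < 2" for x i
    using that by blast
  have d01: "(Dn i u has_vector_derivative Dn (Suc i) u x) (at x within II)" if "x \<in> II" "i < 2" for x i
    using r that differentiable_imp_D[of "Dn i u" x] by (simp add: Dn_simps)
  have d2: "(Dn 2 u has_vector_derivative Dn 3 u x) (at x within II)" if x: "x \<in> II" for x
  proof -
    have "(\<lambda>y. of_real (coeff_a a1 a2 y) * Dn 2 u y) differentiable (at x within II)"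
      using da[OF x, of 0] by (simp add: au2_def[abs_def])
    then have "(Dn 2 u has_vector_derivative
        D (\<lambda>y. of_real (coeff_a a1 a2 y) * Dn 2 u y) x / of_real (coeff_a a1 a2 x)) (at x within II)"
      using differentiable_imp_D coeff_mult_derivative_iff[OF a x] by blast
    with D_eqI[OF x this] show ?thesis by (simp add: Dn_simps)
  qed
  have d3: "(Dn 3 u has_vector_derivative rhs4 a1 a2 q \<mu> u x) (at x within II)" if x: "x \<in> II" for x
  proof -
    have "Dn 1 (au2 a1 a2 u) differentiable (at x within II)"
      using da[OF x, of 1] by simp
    then have "(D (au2 a1 a2 u) has_vector_derivative Dn 2 (au2 a1 a2 u) x) (at x within II)"
      using differentiable_imp_D by (simp add: Dn_simps)
    moreover have "Dn 2 (au2 a1 a2 u) x = (\<mu> - of_real (q x)) * u x"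
      using r x by (auto simp: L_def algebra_simps)
    ultimately show ?thesis
      using D_au2_derivative_iff[OF a disjI1[OF refl] d2 x] by (simp add: rhs4_def)
  qed
  show ?l
    unfolding classical_on_def all_less_3
    using d01[of _ 0] d01[of _ 1] d2 d3 by (simp add: numeral_eq_Suc)
qed

lemma rhs4_continuous:
  assumes "continuous_on II q" "half p r" "continuous_on {p<..<r} u"
  shows "continuous_on {p<..<r} (rhs4 a1 a2 q \<mu> u)"
proof -
  have "continuous_on {p<..<r} (\<lambda>x. (\<mu> - of_real (q x)) * u x / of_real (coeff_a a1 a2 p))"
    unfolding divide_inverse
    by (intro continuous_intros assms(3) continuous_on_subset[OF assms(1)] half_subset assms(2))
  then show ?thesis
    by (rule continuous_on_eq) (use coeff_a_half[OF assms(2)] in \<open>simp add: rhs4_def\<close>)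
qed

section \<open>Almost everywhere statements and square-integrability on I\<close>

lemma II_lmeasurable: "II \<in> lmeasurable"
proof -
  have "II = {-1..1} - {0}" by (auto simp: II_def)
  moreover have "{-1..1::real} - {0} \<in> lmeasurable" by (intro fmeasurable_Diff) auto
  ultimately show ?thesis by simp
qed

lemma AE_II_negligible:
  assumes "AE x in lebesgue_on II. P x"
  obtains N where "negligible N" "\<And>x. x \<in> II - N \<Longrightarrow> P x"
proof -
  have "AE x in lebesgue. x \<in> II \<longrightarrow> P x"
    using assms II_lmeasurable by (subst (asm) AE_restrict_space_iff) (auto dest: fmeasurableD)
  then obtain N where "negligible N" "{x. \<not> (x \<in> II \<longrightarrow> P x)} \<subseteq> N"
    unfolding eventually_ae_filter_negligible by blast
  then show ?thesis using that[of N] by auto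
qed

lemma AE_II_I:
  assumes "\<And>x. x \<in> inner_II \<Longrightarrow> P x"
  shows "AE x in lebesgue_on II. P x"
proof -
  have "{x. \<not> (x \<in> II \<longrightarrow> P x)} \<subseteq> {-1, 1}"
    using assms by (force simp: II_def)
  then have "AE x in lebesgue. x \<in> II \<longrightarrow> P x"
    unfolding eventually_ae_filter_negligible by (intro exI[of _ "{-1, 1}"]) auto
  then show ?thesis
    using II_lmeasurable by (subst AE_restrict_space_iff) (auto dest: fmeasurableD)
qed

text \<open>
  The set where two continuous functions differ is open, and a nonempty open set is not null.
\<close>

lemma AE_eq_imp_eq_inner:
  fixes u w :: "real \<Rightarrow> complex"
  assumes "AE x in lebesgue_on II. u x = w x" "continuous_on inner_II u" "continuous_on inner_II w"
    and "x \<in> inner_II"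
  shows "u x = w x"
proof -
  obtain N where N: "negligible N" "\<And>x. x \<in> II - N \<Longrightarrow> u x = w x"
    using AE_II_negligible[OF assms(1)] by blast
  let ?S = "inner_II \<inter> (\<lambda>x. u x - w x) -` (- {0})"
  have "open ?S"
    by (intro continuous_open_preimage[OF _ open_inner_II] continuous_intros assms(2,3))
  moreover have "negligible ?S"
    by (rule negligible_subset[OF N(1)]) (use N(2) inner_II_subset in auto)
  ultimately have "?S = {}"
    using open_not_negligible by blast
  then show ?thesis using assms(4) by auto
qed


section \<open>From almost everywhere solutions to classical solutions\<close>

text \<open>
  Off a null set \<open>u'''\<close> has the derivative \<open>rhs4\<close>, which is continuous because \<open>u\<close> and \<open>q\<close> are;
  local absolute continuity of \<open>u'''\<close> then gives the derivative everywhere.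
\<close>

lemma AE_equation_imp_classical:
  assumes a: "a1 > 0" "a2 > 0" and q: "continuous_on II q"
    and diff: "\<And>i x. i < 3 \<Longrightarrow> x \<in> inner_II \<Longrightarrow> Dn i u differentiable (at x)"
    and ac: "AC_loc {-1<..<0} (Dn 3 u)" "AC_loc {0<..<1} (Dn 3 u)"
    and ae: "AE x in lebesgue_on II. Dn 1 (au2 a1 a2 u) differentiable (at x)"
    and eq: "AE x in lebesgue_on II. L a1 a2 q u x = \<mu> * u x"
  shows "classical_on a1 a2 q \<mu> inner_II u"
proof -
  have der: "(Dn i u has_vector_derivative Dn (Suc i) u x) (at x within II)" if "i < 3" "x \<in> inner_II" for i x
    using differentiable_imp_D[of "Dn i u" x] diff[OF that] at_within_II_inner[OF that(2)]
    by (simp add: Dn_simps)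
  have d2: "(Dn 2 u has_vector_derivative Dn 3 u x) (at x within II)" if "x \<in> inner_II" for x
    using der[OF _ that, of 2] by (simp add: numeral_eq_Suc)
  have "AE x in lebesgue_on II. Dn 1 (au2 a1 a2 u) differentiable (at x) \<and> L a1 a2 q u x = \<mu> * u x"
    using ae eq by eventually_elim simp
  then obtain N where N: "negligible N"
    "\<And>x. x \<in> II - N \<Longrightarrow> Dn 1 (au2 a1 a2 u) differentiable (at x) \<and> L a1 a2 q u x = \<mu> * u x"
    by (rule AE_II_negligible) blast
  have d3N: "(Dn 3 u has_vector_derivative rhs4 a1 a2 q \<mu> u x) (at x)" if x: "x \<in> inner_II - N" for x
  proof -
    have "x \<in> II" using x inner_II_subset by blast
    then have "D (au2 a1 a2 u) differentiable (at x within II)" "L a1 a2 q u x = \<mu> * u x"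
      using N(2)[of x] x by (auto simp: at_within_II_inner Dn_simps)
    moreover from this have "D (D (au2 a1 a2 u)) x = (\<mu> - of_real (q x)) * u x"
      by (simp add: L_def Dn_simps algebra_simps)
    ultimately have "(D (au2 a1 a2 u) has_vector_derivative (\<mu> - of_real (q x)) * u x) (at x within II)"
      using differentiable_imp_D by metis
    then show ?thesis
      using D_au2_derivative_iff[OF a disjI2[OF refl] d2, of x] x
      by (simp add: rhs4_def at_within_II_inner)
  qed
  have "(Dn 3 u has_vector_derivative rhs4 a1 a2 q \<mu> u x) (at x)" if x: "x \<in> inner_II" for x
  proof -
    obtain p r where pr: "half p r" "x \<in> {p<..<r}" using inner_II_half[OF x] by blast
    show ?thesis
    proof (rule abs_cont_on_derivative_everywhere[OF _ N(1) _ _ pr(2)])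
      show "AC_loc {p<..<r} (Dn 3 u)" using ac pr(1) by (auto simp: half_def)
      show "(Dn 3 u has_vector_derivative rhs4 a1 a2 q \<mu> u y) (at y)" if "y \<in> {p<..<r} - N" for y
        using d3N half_subset(1)[OF pr(1)] that by blast
      have "continuous (at y) u" if "y \<in> {p<..<r}" for y
      proof -
        have "y \<in> inner_II" using half_subset(1)[OF pr(1)] that by blast
        then show ?thesis using diff[of 0 y] by (simp add: differentiable_imp_continuous_within)
      qed
      then show "continuous_on {p<..<r} (rhs4 a1 a2 q \<mu> u)"
        by (intro rhs4_continuous q pr continuous_at_imp_continuous_on) blast
    qed
  qed
  then show ?thesis
    using der at_within_II_inner by (simp add: classical_on_def)
qed

lemma classical_on_subset: "classical_on a1 a2 q \<mu> S u \<Longrightarrow> T \<subseteq> S \<Longrightarrow> classical_on a1 a2 q \<mu> T u"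
  unfolding classical_on_def by blast

lemma classical_on_derivative:
  assumes "classical_on a1 a2 q \<mu> S u" "x \<in> S"
  shows "i < 3 \<Longrightarrow> (Dn i u has_vector_derivative Dn (Suc i) u x) (at x within II)"
    and "(Dn 2 u has_vector_derivative Dn 3 u x) (at x within II)"
    and "(Dn 3 u has_vector_derivative rhs4 a1 a2 q \<mu> u x) (at x within II)"
proof -
  show *: "(Dn i u has_vector_derivative Dn (Suc i) u x) (at x within II)" if "i < 3" for i
    using assms that unfolding classical_on_def by blast
  show "(Dn 2 u has_vector_derivative Dn 3 u x) (at x within II)"
    using *[of 2] by (simp add: numeral_eq_Suc)
  show "(Dn 3 u has_vector_derivative rhs4 a1 a2 q \<mu> u x) (at x within II)"
    using assms unfolding classical_on_def by blast
qed

lemma classical_on_continuous: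
  assumes "classical_on a1 a2 q \<mu> S u" "x \<in> S" "i \<le> 3"
  shows "continuous (at x within II) (Dn i u)"
proof -
  have "i < 3 \<or> i = 3" using assms(3) by auto
  then show ?thesis
    using classical_on_derivative(1,3)[OF assms(1,2)] has_vector_derivative_continuous by blast
qed

lemma classical_on_continuous_half:
  assumes "classical_on a1 a2 q \<mu> inner_II u" "half p r" "i \<le> 3"
  shows "continuous_on {p<..<r} (Dn i u)"
proof (rule continuous_at_imp_continuous_on, rule ballI)
  fix x assume "x \<in> {p<..<r}"
  then have x: "x \<in> inner_II" using half_subset(1)[OF assms(2)] by blast
  show "continuous (at x) (Dn i u)"
    using classical_on_continuous[OF assms(1) x assms(3)] at_within_II_inner[OF x] by simp
qed

lemma classical_on_AC_loc:
  assumes "classical_on a1 a2 q \<mu> inner_II u" "continuous_on II q" "half p r" "i \<le> 3"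
  shows "AC_loc {p<..<r} (Dn i u)"
proof (cases "i = 3")
  case True
  show ?thesis unfolding True
  proof (rule AC_loc_continuous_derivative)
    show "(Dn 3 u has_vector_derivative rhs4 a1 a2 q \<mu> u x) (at x)" if "x \<in> {p<..<r}" for x
    proof -
      have x: "x \<in> inner_II" using half_subset(1)[OF assms(3)] that by blast
      show ?thesis using classical_on_derivative(3)[OF assms(1) x] at_within_II_inner[OF x] by simp
    qed
    show "continuous_on {p<..<r} (rhs4 a1 a2 q \<mu> u)"
      using rhs4_continuous[OF assms(2,3)] classical_on_continuous_half[OF assms(1,3), of 0] by simp
  qed
next
  case False
  then have i: "i < 3" using assms(4) by simp
  show ?thesis
  proof (rule AC_loc_continuous_derivative)
    show "(Dn i u has_vector_derivative Dn (Suc i) u x) (at x)" if "x \<in> {p<..<r}" for x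
    proof -
      have x: "x \<in> inner_II" using half_subset(1)[OF assms(3)] that by blast
      show ?thesis using classical_on_derivative(1)[OF assms(1) x i] at_within_II_inner[OF x] by simp
    qed
    show "continuous_on {p<..<r} (Dn (Suc i) u)"
      using classical_on_continuous_half[OF assms(1,3), of "Suc i"] i by simp
  qed
qed

text \<open>
  The finite limits of \<open>q\<close> at \<open>0\<close> make it continuous up to the closure of each half.
\<close>

lemma potential_extends:
  fixes q :: "real \<Rightarrow> real"
  assumes q: "continuous_on II q" "(q \<longlongrightarrow> q0m) (at_left 0)" "(q \<longlongrightarrow> q0p) (at_right 0)"
    and pr: "half p r"
  obtains Q where "continuous_on {p..r} Q" "\<And>x. x \<in> {p..r} \<Longrightarrow> x \<noteq> 0 \<Longrightarrow> Q x = q x"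
proof -
  define Q where "Q x = (if x = 0 then if p = 0 then q0p else q0m else q x)" for x
  have "continuous (at x within {p..r}) Q" if x: "x \<in> {p..r}" for x
  proof (cases "x = 0")
    case True
    have "(q \<longlongrightarrow> Q 0) (at 0 within {p..r})"
      using pr q by (auto simp: half_def Q_def at_within_Icc_at_right at_within_Icc_at_left)
    moreover have "\<forall>\<^sub>F y in at 0 within {p..r}. q y = Q y"
      by (simp add: eventually_at_filter Q_def)
    ultimately have "(Q \<longlongrightarrow> Q 0) (at 0 within {p..r})"
      by (rule Lim_transform_eventually)
    then show ?thesis by (simp add: continuous_within True)
  next
    case False
    then have "x \<in> II" using x pr by (auto simp: half_def II_def)
    moreover have "at x within II = at x within {p..r}"
      by (rule at_within_nhd[where S = "if x < 0 then {..<0} else {0<..}"])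
         (use False x pr in \<open>auto simp: half_def II_def\<close>)
    ultimately have "(q \<longlongrightarrow> q x) (at x within {p..r})"
      using q(1) unfolding continuous_on_def by metis
    moreover have "\<forall>\<^sub>F y in at x within {p..r}. y \<noteq> 0"
      using False by (auto simp: eventually_at intro!: exI[of _ "\<bar>x\<bar>"])
    then have "\<forall>\<^sub>F y in at x within {p..r}. q y = Q y"
      by (rule eventually_mono) (simp add: Q_def)
    ultimately have "(Q \<longlongrightarrow> q x) (at x within {p..r})"
      by (rule Lim_transform_eventually)
    then show ?thesis using False by (simp add: continuous_within Q_def)
  qed
  then have "continuous_on {p..r} Q" by (simp add: continuous_on_eq_continuous_within)
  then show ?thesis by (rule that) (simp add: Q_def)
qed

lemma sq_int_integrable:
  assumes "sq_int u" shows "integrable (lebesgue_on II) u"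
proof -
  interpret finite_measure "lebesgue_on II" by (rule finite_measure_lebesgue_on[OF II_lmeasurable])
  have "integrable (lebesgue_on II) (\<lambda>x. 1 + (cmod (u x))\<^sup>2)"
    using assms by (simp add: sq_int_def)
  then show ?thesis
  proof (rule Bochner_Integration.integrable_bound)
    show "u \<in> borel_measurable (lebesgue_on II)" using assms by (simp add: sq_int_def)
    \<comment> \<open>square-integrable functions on a set of finite measure are integrable, by comparison with \<open>1 + |u|\<^sup>2\<close>\<close>
    have "t \<le> 1 + t\<^sup>2" for t :: real
      using zero_le_power2[of "t - 1/2"] by (simp add: power2_eq_square algebra_simps)
    then show "AE x in lebesgue_on II. norm (u x) \<le> norm (1 + (cmod (u x))\<^sup>2)"
      by (intro AE_I2) (metis abs_of_nonneg add_nonneg_nonneg real_norm_def zero_le_one zero_le_power2)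
  qed
qed

lemma sq_int_rhs4_integrable:
  assumes q: "continuous_on II q" "(q \<longlongrightarrow> q0m) (at_left 0)" "(q \<longlongrightarrow> q0p) (at_right 0)"
    and pr: "half p r" and u: "sq_int u"
  shows "rhs4 a1 a2 q \<mu> u integrable_on {p..r}"
proof -
  obtain Q where Q: "continuous_on {p..r} Q" "\<And>x. x \<in> {p..r} \<Longrightarrow> x \<noteq> 0 \<Longrightarrow> Q x = q x"
    using potential_extends[OF q pr] by blast
  let ?c = "\<lambda>x. (\<mu> - of_real (Q x)) / of_real (coeff_a a1 a2 ((p + r) / 2)) :: complex"
  have c: "continuous_on {p..r} ?c"
    unfolding divide_inverse by (intro continuous_intros Q(1))
  have "u absolutely_integrable_on II"
    using sq_int_integrable[OF u] II_lmeasurable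
    unfolding set_integrable_def by (subst (asm) integrable_restrict_space) (auto dest: fmeasurableD)
  then have "u absolutely_integrable_on {p<..<r}"
    by (rule set_integrable_subset) (use half_subset(2)[OF pr] in auto)
  then have "u absolutely_integrable_on {p..r}"
    by (simp add: absolutely_integrable_on_Icc_iff_Ioo)
  then have "(\<lambda>x. ?c x * u x) absolutely_integrable_on {p..r}"
  proof (rule absolutely_integrable_bounded_measurable_product[OF bilinear_times, rotated 3])
    show "?c \<in> borel_measurable (lebesgue_on {p..r})"
      by (rule continuous_imp_measurable_on_sets_lebesgue[OF c]) simp
    show "bounded (?c ` {p..r})"
      by (rule compact_imp_bounded[OF compact_continuous_image[OF c]]) simp
  qed simp
  then have "(\<lambda>x. ?c x * u x) integrable_on {p..r}"
    by (rule set_lebesgue_integral_eq_integral(1))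
  then show ?thesis
  proof (rule integrable_spike_finite[of "{p, r}", rotated 2])
    fix x assume x: "x \<in> {p..r} - {p, r}"
    have "coeff_a a1 a2 x = coeff_a a1 a2 ((p + r) / 2)" "x \<noteq> 0"
      using x pr by (auto simp: half_def coeff_a_def)
    then show "rhs4 a1 a2 q \<mu> u x = ?c x * u x"
      using Q(2)[of x] x by (simp add: rhs4_def)
  qed simp
qed

text \<open>
  Downward induction on the order of the derivative: \<open>u''''\<close> is integrable since \<open>u\<close> is
  square-integrable and \<open>q\<close> is bounded, so \<open>u'''\<close> extends continuously to the closed half; hence it
  is integrable in turn, so \<open>u''\<close> extends, and so on.
\<close>

lemma classical_on_extends:
  assumes q: "continuous_on II q" "(q \<longlongrightarrow> q0m) (at_left 0)" "(q \<longlongrightarrow> q0p) (at_right 0)"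
    and cl: "classical_on a1 a2 q \<mu> inner_II u" and u: "sq_int u" and pr: "half p r" and i: "i \<le> 3"
  shows "extends_to_Icc p r (Dn i u)"
proof -
  have inner: "x \<in> inner_II" if "x \<in> {p<..<r}" for x using half_subset(1)[OF pr] that by blast
  show ?thesis
    using i
  proof (induction i rule: inc_induct)
    case base
    show ?case
    proof (rule integrable_derivative_extends[OF half_less[OF pr]])
      show "(Dn 3 u has_vector_derivative rhs4 a1 a2 q \<mu> u x) (at x)" if "x \<in> {p<..<r}" for x
        using classical_on_derivative(3)[OF cl inner[OF that]] at_within_II_inner[OF inner[OF that]]
        by simp
      show "rhs4 a1 a2 q \<mu> u integrable_on {p..r}"
        by (rule sq_int_rhs4_integrable[OF q pr u])
    qed
  next
    case (step j)
    show ?case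
    proof (rule integrable_derivative_extends[OF half_less[OF pr]])
      show "(Dn j u has_vector_derivative Dn (Suc j) u x) (at x)" if "x \<in> {p<..<r}" for x
        using classical_on_derivative(1)[OF cl inner[OF that] step.hyps(2)]
          at_within_II_inner[OF inner[OF that]] by simp
      show "Dn (Suc j) u integrable_on {p..r}"
        by (rule extends_to_Icc_integrable[OF step.IH])
    qed
  qed
qed

text \<open>
  Replacing the values of \<open>u\<close> at \<open>-1\<close> and \<open>1\<close> by limits turns a solution inside into one on \<open>I\<close>:
  the extended functions \<open>V i\<close> satisfy the chain of derivatives up to the end points, and
  \<open>V i\<close> is then the \<open>i\<close>-th derivative of \<open>V 0\<close> within \<open>II\<close>.
\<close>

lemma classical_on_endpoints:
  assumes a: "a1 > 0" "a2 > 0" and q: "continuous_on II q" "(q \<longlongrightarrow> q0m) (at_left 0)" "(q \<longlongrightarrow> q0p) (at_right 0)"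
    and cl: "classical_on a1 a2 q \<mu> inner_II u"
    and ext: "\<And>p r i. half p r \<Longrightarrow> i \<le> 3 \<Longrightarrow> extends_to_Icc p r (Dn i u)"
  obtains w where "classical_on a1 a2 q \<mu> II w" "\<And>x. x \<in> inner_II \<Longrightarrow> w x = u x"
proof -
  define W where "W p r i = (SOME W. continuous_on {p..r} W \<and> (\<forall>x\<in>{p<..<r}. W x = Dn i u x))" for p r i
  have "continuous_on {p..r} (W p r i) \<and> (\<forall>x\<in>{p<..<r}. W p r i x = Dn i u x)"
    if "half p r" "i \<le> 3" for p r i
    using ext[OF that] unfolding extends_to_Icc_def W_def by (rule someI_ex)
  then have W: "\<And>p r i. half p r \<Longrightarrow> i \<le> 3 \<Longrightarrow> continuous_on {p..r} (W p r i)"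
    "\<And>p r i x. half p r \<Longrightarrow> i \<le> 3 \<Longrightarrow> x \<in> {p<..<r} \<Longrightarrow> W p r i x = Dn i u x"
    by blast+
  define V where "V i x = (if x < 0 then W (-1) 0 i x else W 0 1 i x)" for i x
  have V_W: "V i x = W p r i x" if "half p r" "x \<in> {p..r}" "x \<noteq> 0" for p r i x
    using that by (auto simp: half_def V_def)
  have V_inner: "V i x = Dn i u x" if "x \<in> inner_II" "i \<le> 3" for i x
    using that W(2)[of "-1" 0 i x] W(2)[of 0 1 i x] by (auto simp: V_def half_def)
  have V_der: "(V i has_vector_derivative G x) (at x within II)"
    if x: "x \<in> II" and i: "i \<le> 3"
      and G: "\<And>p r. half p r \<Longrightarrow> \<exists>G'. continuous_on {p..r} G' \<and> (\<forall>y\<in>{p..r}-{0}. G' y = G y)"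
      and der: "\<And>y. y \<in> inner_II \<Longrightarrow> (Dn i u has_vector_derivative G y) (at y within II)" for i x G
  proof -
    obtain p r where pr: "half p r" "x \<in> {p..r}" "at x within II = at x within {p..r}"
      using II_cases[OF x] .
    obtain G' where G': "continuous_on {p..r} G'" "\<forall>y\<in>{p..r}-{0}. G' y = G y"
      using G[OF pr(1)] by blast
    have "(W p r i has_vector_derivative G' x) (at x within {p..r})"
    proof (rule derivative_on_closure[OF W(1)[OF pr(1) i] G'(1) _ pr(2)])
      fix y assume y: "y \<in> {p<..<r}"
      then have yi: "y \<in> inner_II" using half_subset(1)[OF pr(1)] by blast
      have "y \<in> {p..r} - {0}" using y pr(1) by (auto simp: half_def)
      then have "(Dn i u has_vector_derivative G' y) (at y)"
        using der[OF yi] at_within_II_inner[OF yi] G'(2) by simp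
      then show "(W p r i has_vector_derivative G' y) (at y)"
        by (rule has_vector_derivative_transform_within_open[where S = "{p<..<r}"])
           (use y W(2)[OF pr(1) i] in auto)
    qed
    moreover have x0: "x \<noteq> 0" using x by (auto simp: II_def)
    ultimately have "(W p r i has_vector_derivative G x) (at x within II)"
      using G'(2) pr(2,3) by simp
    then show ?thesis
    proof (rule has_vector_derivative_transform_within[where d = "\<bar>x\<bar>"])
      fix y assume "y \<in> II" "dist y x < \<bar>x\<bar>"
      then have "y \<in> {p..r}" "y \<noteq> 0" using pr(1,2) x by (auto simp: half_def II_def dist_real_def)
      then show "W p r i y = V i y" using V_W[OF pr(1)] by simp
    qed (use x x0 in auto)
  qed
  have V_Suc: "(V i has_vector_derivative V (Suc i) x) (at x within II)" if "x \<in> II" "i < 3" for i x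
  proof (rule V_der[OF that(1)])
    show "\<exists>G'. continuous_on {p..r} G' \<and> (\<forall>y\<in>{p..r}-{0}. G' y = V (Suc i) y)" if "half p r" for p r
      using W(1)[OF that, of "Suc i"] V_W[OF that] \<open>i < 3\<close> by (intro exI[of _ "W p r (Suc i)"]) auto
    show "(Dn i u has_vector_derivative V (Suc i) y) (at y within II)" if "y \<in> inner_II" for y
      using classical_on_derivative(1)[OF cl that \<open>i < 3\<close>] V_inner[OF that, of "Suc i"] \<open>i < 3\<close> by simp
  qed (use that in simp)
  have V_3: "(V 3 has_vector_derivative rhs4 a1 a2 q \<mu> (V 0) x) (at x within II)" if "x \<in> II" for x
  proof (rule V_der[OF that])
    show "\<exists>G'. continuous_on {p..r} G' \<and> (\<forall>y\<in>{p..r}-{0}. G' y = rhs4 a1 a2 q \<mu> (V 0) y)"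
      if pr: "half p r" for p r
    proof -
      obtain Q where Q: "continuous_on {p..r} Q" "\<And>x. x \<in> {p..r} \<Longrightarrow> x \<noteq> 0 \<Longrightarrow> Q x = q x"
        using potential_extends[OF q pr] by blast
      let ?G = "\<lambda>x. (\<mu> - of_real (Q x)) * W p r 0 x / of_real (coeff_a a1 a2 ((p + r) / 2))"
      have "continuous_on {p..r} ?G"
        unfolding divide_inverse by (intro continuous_intros Q(1) W(1)[OF pr]) simp
      moreover have "?G y = rhs4 a1 a2 q \<mu> (V 0) y" if "y \<in> {p..r} - {0}" for y
      proof -
        have "coeff_a a1 a2 y = coeff_a a1 a2 ((p + r) / 2)"
          using that pr by (auto simp: half_def coeff_a_def)
        then show ?thesis using Q(2)[of y] V_W[OF pr, of y 0] that by (simp add: rhs4_def)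
      qed
      ultimately show ?thesis by (intro exI[of _ ?G]) auto
    qed
    show "(Dn 3 u has_vector_derivative rhs4 a1 a2 q \<mu> (V 0) y) (at y within II)" if "y \<in> inner_II" for y
      using classical_on_derivative(3)[OF cl that] V_inner[OF that, of 0] by (simp add: rhs4_def)
  qed simp
  have DV: "Dn i (V 0) x = V i x" if "x \<in> II" "i \<le> 3" for i x
    using that
  proof (induction i arbitrary: x)
    case (Suc i)
    have "(Dn i (V 0) has_vector_derivative V (Suc i) x) (at x within II)"
      by (rule has_vector_derivative_transform[OF _ _ V_Suc]) (use Suc in auto)
    then show ?case using D_eqI[OF Suc.prems(1)] by (simp add: Dn_simps(2))
  qed simp
  have "classical_on a1 a2 q \<mu> II (V 0)"
    unfolding classical_on_def
  proof (intro ballI conjI allI impI)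
    fix x assume x: "x \<in> II"
    show "(Dn i (V 0) has_vector_derivative Dn (Suc i) (V 0) x) (at x within II)" if "i < 3" for i
      by (rule has_vector_derivative_transform[OF x, of _ "V i"])
         (use that x DV V_Suc[OF x that] in \<open>auto simp del: funpow.simps\<close>)
    show "(Dn 3 (V 0) has_vector_derivative rhs4 a1 a2 q \<mu> (V 0) x) (at x within II)"
      by (rule has_vector_derivative_transform[OF x, of _ "V 3"]) (use DV V_3[OF x] in auto)
  qed
  then show ?thesis using that[of "V 0"] V_inner[of _ 0] by simp
qed

section \<open>Solutions that are classical on all of I\<close>

lemma at_within_II_ends:
  "at (-1) within II = at_right (-1)" "at 1 within II = at_left 1"
proof -
  have "at (-1) within II = at (-1) within {-1..0}"
    by (rule at_within_nhd[where S = "{..<0}"]) (auto simp: II_def)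
  then show "at (-1) within II = at_right (-1)" by (simp add: at_within_Icc_at_right)
  have "at 1 within II = at 1 within {0..1}"
    by (rule at_within_nhd[where S = "{0<..}"]) (auto simp: II_def)
  then show "at 1 within II = at_left 1" by (simp add: at_within_Icc_at_left)
qed

lemma bounded_continuous_sq_int:
  assumes "continuous_on II u" "bounded (u ` II)"
  shows "sq_int u"
proof -
  interpret finite_measure "lebesgue_on II" by (rule finite_measure_lebesgue_on[OF II_lmeasurable])
  have m: "u \<in> borel_measurable (lebesgue_on II)"
    by (intro continuous_imp_measurable_on_sets_lebesgue assms(1) fmeasurableD II_lmeasurable)
  obtain B where B: "\<And>x. x \<in> II \<Longrightarrow> cmod (u x) \<le> B"
    using assms(2) by (auto simp: bounded_iff)
  have "integrable (lebesgue_on II) (\<lambda>x. (cmod (u x))\<^sup>2)"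
  proof (rule integrable_const_bound)
    show "AE x in lebesgue_on II. norm ((cmod (u x))\<^sup>2) \<le> B\<^sup>2"
      by (rule AE_I2) (use B in \<open>auto intro: power_mono\<close>)
  qed (use m in measurable)
  then show ?thesis using m by (simp add: sq_int_def)
qed

text \<open>
  A solution on \<open>I\<close> is continuous at \<open>-1\<close> and \<open>1\<close> and has limits at \<open>0\<close>, so it is bounded.
\<close>

lemma classical_on_II_sq_int:
  assumes cl: "classical_on a1 a2 q \<mu> II u"
    and "\<exists>l. (u \<longlongrightarrow> l) (at_left 0)" "\<exists>l. (u \<longlongrightarrow> l) (at_right 0)"
  shows "sq_int u"
proof (rule bounded_continuous_sq_int)
  have c: "(u \<longlongrightarrow> u x) (at x within II)" if "x \<in> II" for x
    using classical_on_continuous[OF cl that, of 0] by (simp add: continuous_within)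
  then show "continuous_on II u" by (simp add: continuous_on_def)
  then have ci: "continuous_on {p<..<r} u" if "half p r" for p r
    using half_subset(2)[OF that] continuous_on_subset by blast
  have "(u \<longlongrightarrow> u (-1)) (at_right (-1))" "(u \<longlongrightarrow> u 1) (at_left 1)"
    using c[of "-1"] c[of 1] at_within_II_ends by (auto simp: II_def)
  then have "extends_to_Icc (-1) 0 u" "extends_to_Icc 0 1 u"
    using assms(2,3) extends_to_Icc_iff_limits[of "-1" 0 u] extends_to_Icc_iff_limits[of 0 1 u]
      ci[of "-1" 0] ci[of 0 1] by (auto simp: half_def)
  then have "bounded (u ` {-1<..<0} \<union> u ` {0<..<1} \<union> {u (-1), u 1})"
    by (simp add: extends_to_Icc_bounded)
  then show "bounded (u ` II)"
    by (rule bounded_subset) (force simp: II_def)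
qed

section \<open>Representatives and the eigenvalue equation of A\<close>

lemma Lim_inner_cong:
  assumes "\<forall>x\<in>inner_II. u x = w x"
  shows "at_m1 u = at_m1 w" "at_0m u = at_0m w" "at_0p u = at_0p w" "at_p1 u = at_p1 w"
proof -
  have Lim_eq: "Lim F u = Lim F w" if "\<forall>\<^sub>F x in F. x \<in> {p<..<r}" "half p r" for F p r
  proof -
    have "\<forall>\<^sub>F x in F. u x = w x"
      using that(1) by (rule eventually_mono) (use assms half_subset(1)[OF that(2)] in blast)
    then show ?thesis unfolding Topological_Spaces.Lim_def by (simp add: tendsto_cong)
  qed
  show "at_m1 u = at_m1 w" "at_0m u = at_0m w" "at_0p u = at_0p w" "at_p1 u = at_p1 w"
    unfolding at_m1_def at_0m_def at_0p_def at_p1_def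
    using Lim_eq eventually_inside_Ioo[of "-1" 0] eventually_inside_Ioo[of 0 1]
    by (auto simp: half_def)
qed

lemma abs_l2_eq_iff:
  assumes "sq_int u" "sq_int w"
  shows "abs_l2 u = abs_l2 w \<longleftrightarrow> (AE x in lebesgue_on II. u x = w x)"
  using Quotient3_rel[OF Quotient3_l2, of u w] assms by (auto simp: l2_rel_def)

lemma scale_l2_abs:
  assumes "sq_int u"
  shows "scale_l2 c (abs_l2 u) = abs_l2 (\<lambda>x. c * u x)"
  using assms by (intro scale_l2.abs_eq) (simp add: l2_rel_def)

lemma sq_int_cong:
  assumes "sq_int u" "\<And>x. x \<in> II \<Longrightarrow> w x = u x"
  shows "sq_int w"
proof -
  have "w \<in> borel_measurable (lebesgue_on II) \<longleftrightarrow> u \<in> borel_measurable (lebesgue_on II)"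
    by (rule measurable_cong) (simp add: assms(2))
  moreover have "integrable (lebesgue_on II) (\<lambda>x. (cmod (w x))\<^sup>2) \<longleftrightarrow>
      integrable (lebesgue_on II) (\<lambda>x. (cmod (u x))\<^sup>2)"
    by (rule Bochner_Integration.integrable_cong) (simp_all add: assms(2))
  ultimately show ?thesis using assms(1) by (simp add: sq_int_def)
qed

text \<open>
  The components \<open>h\<^sub>1, \<dots>, h\<^sub>4\<close> of an element of \<open>D(A)\<close> are determined by any of its representatives.
\<close>

definition element_of :: "real \<Rightarrow> real \<Rightarrow> (real \<Rightarrow> complex) \<Rightarrow> Z" where
  "element_of \<delta>1 \<delta>2 u = (abs_l2 u, at_p1 u, at_p1 (Dn 1 u),
     - of_real \<delta>1 * at_0m (Dn 1 u), - of_real \<delta>2 * at_0m u)"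

lemma dom_rep_iff:
  "dom_rep a1 a2 q \<beta>1 \<beta>2 \<delta>1 \<delta>2 F u \<longleftrightarrow>
     F = element_of \<delta>1 \<delta>2 u \<and> sq_int u \<and>
     (\<forall>i<3. \<forall>x\<in>inner_II. Dn i u differentiable (at x)) \<and>
     (\<forall>i\<le>3. AC_loc {-1<..<0} (Dn i u) \<and> AC_loc {0<..<1} (Dn i u)) \<and>
     (AE x in lebesgue_on II. Dn 1 (au2 a1 a2 u) differentiable (at x)) \<and>
     sq_int (L a1 a2 q u) \<and> L1 u = 0 \<and> L2 \<beta>1 \<beta>2 u = 0 \<and> L3 u = 0 \<and> L4 u = 0"
  by (cases F) (simp only: dom_rep_def element_of_def represents_def prod.case prod.inject, blast)

lemma dom_rep_continuous:
  assumes "dom_rep a1 a2 q \<beta>1 \<beta>2 \<delta>1 \<delta>2 F u"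
  shows "continuous_on inner_II u"
proof (rule continuous_at_imp_continuous_on, rule ballI)
  fix x assume "x \<in> inner_II"
  moreover have "\<forall>i<3. \<forall>x\<in>inner_II. Dn i u differentiable (at x)"
    using assms unfolding dom_rep_iff by blast
  ultimately have "Dn 0 u differentiable (at x)" by (blast intro: zero_less_numeral)
  then show "continuous (at x) u" by (simp add: differentiable_imp_continuous_within)
qed

lemma dom_rep_inner_unique:
  assumes u: "dom_rep a1 a2 q \<beta>1 \<beta>2 \<delta>1 \<delta>2 F u" and w: "dom_rep a1 a2 q \<beta>1 \<beta>2 \<delta>1 \<delta>2 F w"
    and x: "x \<in> inner_II"
  shows "u x = w x"
proof (rule AE_eq_imp_eq_inner[OF _ dom_rep_continuous[OF u] dom_rep_continuous[OF w] x])
  have "sq_int u" "sq_int w" "element_of \<delta>1 \<delta>2 u = element_of \<delta>1 \<delta>2 w"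
    using u w unfolding dom_rep_iff by metis+
  then show "AE x in lebesgue_on II. u x = w x"
    using abs_l2_eq_iff by (simp add: element_of_def)
qed

lemma L_inner_cong:
  assumes "\<And>x. x \<in> inner_II \<Longrightarrow> u x = w x" "x \<in> inner_II"
  shows "L a1 a2 q u x = L a1 a2 q w x"
proof -
  have "au2 a1 a2 u x = au2 a1 a2 w x" if "x \<in> inner_II" for x
    unfolding au2_def using Dn_inner_cong[OF assms(1) that] by simp
  then show ?thesis
    unfolding L_def using Dn_inner_cong[of "au2 a1 a2 u" "au2 a1 a2 w"] assms by simp
qed

lemma Lim_Dn_inner_cong:
  assumes "\<forall>x\<in>inner_II. u x = w x"
  shows "at_m1 (Dn i u) = at_m1 (Dn i w)" "at_0m (Dn i u) = at_0m (Dn i w)"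
    "at_0p (Dn i u) = at_0p (Dn i w)" "at_p1 (Dn i u) = at_p1 (Dn i w)"
  using Lim_inner_cong[of "Dn i u" "Dn i w"] Dn_inner_cong[of u w] assms by blast+

text \<open>
  The operator uses a chosen representative; any other one agrees with it inside \<open>I\<close>, which
  suffices since \<open>Lu\<close> matters only up to null sets and the boundary terms are limits.
\<close>

lemma op_A_eq:
  assumes u: "dom_rep a1 a2 q \<beta>1 \<beta>2 \<delta>1 \<delta>2 F u"
  shows "op_A a1 a2 q \<beta>1 \<beta>2 \<delta>1 \<delta>2 F =
     (abs_l2 (L a1 a2 q u), - at_p1 (Dn 3 u), - at_p1 (Dn 2 u),
      at_0p (Dn 2 u) - at_0m (Dn 2 u), at_0p (Dn 3 u) - at_0m (Dn 3 u))"
proof -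
  define w where "w = (SOME w. dom_rep a1 a2 q \<beta>1 \<beta>2 \<delta>1 \<delta>2 F w)"
  have w: "dom_rep a1 a2 q \<beta>1 \<beta>2 \<delta>1 \<delta>2 F w"
    unfolding w_def by (rule someI[of "dom_rep a1 a2 q \<beta>1 \<beta>2 \<delta>1 \<delta>2 F" u]) (rule u)
  have eq: "\<forall>x\<in>inner_II. w x = u x" using dom_rep_inner_unique[OF w u] by blast
  have "sq_int (L a1 a2 q u)" "sq_int (L a1 a2 q w)"
    using u w unfolding dom_rep_iff by blast+
  moreover have "AE x in lebesgue_on II. L a1 a2 q w x = L a1 a2 q u x"
    by (rule AE_II_I) (use eq in \<open>auto intro: L_inner_cong\<close>)
  ultimately have "abs_l2 (L a1 a2 q w) = abs_l2 (L a1 a2 q u)" by (simp add: abs_l2_eq_iff)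
  then show ?thesis
    unfolding op_A_def Let_def w_def[symmetric] Lim_Dn_inner_cong[OF eq] by simp
qed

lemma conditions_inner_cong:
  assumes "\<forall>x\<in>inner_II. u x = w x"
  shows "L1 u = L1 w" "L2 \<beta>1 \<beta>2 u = L2 \<beta>1 \<beta>2 w" "L3 u = L3 w" "L4 u = L4 w"
    "L5 \<delta>1 \<mu> u = L5 \<delta>1 \<mu> w" "L6 \<delta>2 \<mu> u = L6 \<delta>2 \<mu> w" "L7 \<mu> u = L7 \<mu> w" "L8 \<mu> u = L8 \<mu> w"
  unfolding L1_def L2_def L3_def L4_def L5_def L6_def L7_def L8_def
  by (simp_all only: Lim_inner_cong[OF assms] Lim_Dn_inner_cong[OF assms])

text \<open>
  The heart of the matter: with \<open>h\<^sub>1 = f(1)\<close>, \<open>h\<^sub>2 = f'(1)\<close>, \<open>h\<^sub>3 = -\<delta>\<^sub>1 f'(0)\<close>, \<open>h\<^sub>4 = -\<delta>\<^sub>2 f(0)\<close>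
  the four scalar components of \<open>AF = \<mu>F\<close> are precisely the four conditions that contain \<open>\<mu>\<close>.
\<close>

lemma eigen_equation_iff:
  assumes rep: "dom_rep a1 a2 q \<beta>1 \<beta>2 \<delta>1 \<delta>2 F u"
  shows "op_A a1 a2 q \<beta>1 \<beta>2 \<delta>1 \<delta>2 F = scale_Z \<mu> F \<longleftrightarrow>
     (AE x in lebesgue_on II. L a1 a2 q u x = \<mu> * u x) \<and>
     L5 \<delta>1 \<mu> u = 0 \<and> L6 \<delta>2 \<mu> u = 0 \<and> L7 \<mu> u = 0 \<and> L8 \<mu> u = 0"
proof -
  have F: "F = element_of \<delta>1 \<delta>2 u" and sq: "sq_int u" "sq_int (L a1 a2 q u)"
    using rep unfolding dom_rep_iff by blast+
  have "abs_l2 (L a1 a2 q u) = scale_l2 \<mu> (abs_l2 u) \<longleftrightarrow>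
      (AE x in lebesgue_on II. L a1 a2 q u x = \<mu> * u x)"
    using sq by (simp add: scale_l2_abs abs_l2_eq_iff sq_int_scale)
  moreover have
    "- at_p1 (Dn 3 u) = \<mu> * at_p1 u \<longleftrightarrow> L7 \<mu> u = 0"
    "- at_p1 (Dn 2 u) = \<mu> * at_p1 (Dn 1 u) \<longleftrightarrow> L8 \<mu> u = 0"
    "at_0p (Dn 2 u) - at_0m (Dn 2 u) = \<mu> * (- of_real \<delta>1 * at_0m (Dn 1 u)) \<longleftrightarrow> L5 \<delta>1 \<mu> u = 0"
    "at_0p (Dn 3 u) - at_0m (Dn 3 u) = \<mu> * (- of_real \<delta>2 * at_0m u) \<longleftrightarrow> L6 \<delta>2 \<mu> u = 0"
    unfolding L5_def L6_def L7_def L8_def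
    unfolding eq_neg_iff_add_eq_0[symmetric] by (auto simp: mult.assoc)
  ultimately show ?thesis
    unfolding op_A_eq[OF rep] unfolding F element_of_def scale_Z_def prod.case prod.inject
    by blast
qed

text \<open>
  A nontrivial eigenelement has a nontrivial first component, because the other components are
  boundary values of the first.
\<close>

lemma element_of_eq_0_iff:
  assumes "sq_int u" "continuous_on inner_II u"
  shows "element_of \<delta>1 \<delta>2 u = 0 \<longleftrightarrow> (\<forall>x\<in>inner_II. u x = 0)"
proof
  assume "element_of \<delta>1 \<delta>2 u = 0"
  then have "abs_l2 u = abs_l2 (\<lambda>x. 0)"
    by (simp add: element_of_def zero_prod_def zero_l2_def)
  then have "AE x in lebesgue_on II. u x = 0"
    using abs_l2_eq_iff[OF assms(1) sq_int_zero] by simp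
  then show "\<forall>x\<in>inner_II. u x = 0"
    using AE_eq_imp_eq_inner[OF _ assms(2) continuous_on_const] by blast
next
  assume z: "\<forall>x\<in>inner_II. u x = 0"
  then have "AE x in lebesgue_on II. u x = 0" by (intro AE_II_I) blast
  then have abs0: "abs_l2 u = 0"
    using abs_l2_eq_iff[OF assms(1) sq_int_zero] by (simp add: zero_l2_def)
  have lim0: "at_m1 (\<lambda>x. 0) = 0" "at_0m (\<lambda>x. 0) = 0" "at_0p (\<lambda>x. 0) = 0" "at_p1 (\<lambda>x. 0) = 0"
    unfolding at_m1_def at_0m_def at_0p_def at_p1_def by (simp_all add: tendsto_Lim)
  have "\<forall>x\<in>inner_II. Dn 1 (\<lambda>x. 0) x = 0"
    using D_eqI[of _ "\<lambda>x. 0" 0] inner_II_subset by (auto simp: Dn_simps)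
  note D0 = Lim_inner_cong[OF this]
  moreover have "at_p1 u = 0" "at_0m u = 0" "at_p1 (Dn 1 u) = 0" "at_0m (Dn 1 u) = 0"
    unfolding Lim_inner_cong[OF z] Lim_Dn_inner_cong[OF z] D0 lim0
    by (rule refl)+
  ultimately show "element_of \<delta>1 \<delta>2 u = 0"
    using abs0 by (simp add: element_of_def zero_prod_def)
qed

section \<open>Eigenfunctions and eigenelements\<close>

text \<open>
  By continuity, a solution that vanishes inside \<open>I\<close> vanishes at \<open>-1\<close> and \<open>1\<close> too.
\<close>

lemma classical_on_II_nonzero_inner:
  assumes cl: "classical_on a1 a2 q \<mu> II u"
  shows "(\<exists>x\<in>II. u x \<noteq> 0) \<longleftrightarrow> (\<exists>x\<in>inner_II. u x \<noteq> 0)"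
proof
  assume "\<exists>x\<in>II. u x \<noteq> 0"
  then obtain x where x: "x \<in> II" "u x \<noteq> 0" by blast
  show "\<exists>x\<in>inner_II. u x \<noteq> 0"
  proof (rule ccontr)
    assume "\<not> (\<exists>x\<in>inner_II. u x \<noteq> 0)"
    then have z: "\<And>x. x \<in> inner_II \<Longrightarrow> u x = 0" by blast
    then have "x \<notin> inner_II" using x(2) by blast
    then have x_end: "x = -1 \<or> x = 1" using x(1) by (auto simp: II_def)
    have "\<forall>\<^sub>F y in at x within II. y \<in> inner_II"
      using x_end eventually_inside_Ioo(1)[of "-1" 0] eventually_inside_Ioo(2)[of 0 1]
      by (auto simp: at_within_II_ends elim: eventually_mono)
    then have "\<forall>\<^sub>F y in at x within II. u y = 0" by (rule eventually_mono) (rule z)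
    then have "(u \<longlongrightarrow> 0) (at x within II)" by (rule tendsto_eventually)
    moreover have "(u \<longlongrightarrow> u x) (at x within II)"
      using classical_on_continuous[OF cl x(1), of 0] by (simp add: continuous_within)
    moreover have "at x within II \<noteq> bot" using x_end by (auto simp: at_within_II_ends)
    ultimately show False using x(2) tendsto_unique by blast
  qed
qed (use inner_II_subset in blast)

lemma P_solution_classical:
  assumes "a1 > 0" "a2 > 0" "P_solution a1 a2 q \<beta>1 \<beta>2 \<delta>1 \<delta>2 \<mu> u"
  shows "classical_on a1 a2 q \<mu> II u" "sq_int u"
proof -
  show cl: "classical_on a1 a2 q \<mu> II u"
    using assms(3) unfolding classical_on_II_iff[OF assms(1,2)] P_solution_def by blast
  have "\<forall>i\<le>3. (\<exists>l. (Dn i u \<longlongrightarrow> l) (at_left 0)) \<and> (\<exists>l. (Dn i u \<longlongrightarrow> l) (at_right 0))"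
    using assms(3) unfolding P_solution_def by blast
  from this[rule_format, of 0] show "sq_int u"
    by (intro classical_on_II_sq_int[OF cl]) auto
qed

lemma P_solution_dom_rep:
  assumes a: "a1 > 0" "a2 > 0" and q: "continuous_on II q"
    and P: "P_solution a1 a2 q \<beta>1 \<beta>2 \<delta>1 \<delta>2 \<mu> u"
  shows "dom_rep a1 a2 q \<beta>1 \<beta>2 \<delta>1 \<delta>2 (element_of \<delta>1 \<delta>2 u) u"
proof -
  note cl = P_solution_classical(1)[OF a P] and sq = P_solution_classical(2)[OF a P]
  have ci: "classical_on a1 a2 q \<mu> inner_II u" by (rule classical_on_subset[OF cl inner_II_subset])
  have Leq: "L a1 a2 q u x = \<mu> * u x" if "x \<in> II" for x
    using P that unfolding P_solution_def by blast
  have diff: "Dn i u differentiable (at x)" if "i < 3" "x \<in> inner_II" for i x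
    using differentiableI_vector[OF classical_on_derivative(1)[OF ci that(2,1)]]
      at_within_II_inner[OF that(2)] by simp
  have "AC_loc {-1<..<0} (Dn i u)" "AC_loc {0<..<1} (Dn i u)" if "i \<le> 3" for i
    using classical_on_AC_loc[OF ci q _ that] by (simp_all add: half_def)
  moreover have "Dn 1 (au2 a1 a2 u) differentiable (at x)" if x: "x \<in> inner_II" for x
  proof -
    have "x \<in> II" using x inner_II_subset by blast
    then have "Dn 1 (au2 a1 a2 u) differentiable (at x within II)"
      using P unfolding P_solution_def by (metis one_less_numeral_iff semiring_norm(76))
    then show ?thesis using at_within_II_inner[OF x] by simp
  qed
  then have "AE x in lebesgue_on II. Dn 1 (au2 a1 a2 u) differentiable (at x)"
    by (rule AE_II_I)
  moreover have "sq_int (L a1 a2 q u)"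
    by (rule sq_int_cong[OF sq_int_scale[OF sq, of \<mu>] Leq])
  moreover have "L1 u = 0" "L2 \<beta>1 \<beta>2 u = 0" "L3 u = 0" "L4 u = 0"
    using P unfolding P_solution_def by blast+
  ultimately show ?thesis
    unfolding dom_rep_iff using sq diff by blast
qed

lemma P_eigenfunction_eigenelement:
  assumes a: "a1 > 0" "a2 > 0" and q: "continuous_on II q"
    and P: "P_eigenfunction a1 a2 q \<beta>1 \<beta>2 \<delta>1 \<delta>2 \<mu> u"
  shows "eigenelement (dom_A a1 a2 q \<beta>1 \<beta>2 \<delta>1 \<delta>2) (op_A a1 a2 q \<beta>1 \<beta>2 \<delta>1 \<delta>2) \<mu> (element_of \<delta>1 \<delta>2 u)"
proof -
  have Ps: "P_solution a1 a2 q \<beta>1 \<beta>2 \<delta>1 \<delta>2 \<mu> u" and nz: "\<exists>x\<in>II. u x \<noteq> 0"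
    using P by (auto simp: P_eigenfunction_def)
  note cl = P_solution_classical(1)[OF a Ps] and sq = P_solution_classical(2)[OF a Ps]
  note rep = P_solution_dom_rep[OF a q Ps]
  have "continuous_on II u"
    using classical_on_continuous[OF cl, of _ 0] by (simp add: continuous_on_eq_continuous_within)
  then have "continuous_on inner_II u" by (rule continuous_on_subset[OF _ inner_II_subset])
  then have "element_of \<delta>1 \<delta>2 u \<noteq> 0"
    using element_of_eq_0_iff[OF sq] nz classical_on_II_nonzero_inner[OF cl] by blast
  moreover have "AE x in lebesgue_on II. L a1 a2 q u x = \<mu> * u x"
    using Ps inner_II_subset unfolding P_solution_def by (intro AE_II_I) blast
  then have "op_A a1 a2 q \<beta>1 \<beta>2 \<delta>1 \<delta>2 (element_of \<delta>1 \<delta>2 u) = scale_Z \<mu> (element_of \<delta>1 \<delta>2 u)"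
    unfolding eigen_equation_iff[OF rep] using Ps unfolding P_solution_def by blast
  ultimately show ?thesis
    using rep by (auto simp: eigenelement_def dom_A_def)
qed

lemma eigenelement_P_eigenfunction:
  assumes a: "a1 > 0" "a2 > 0" and q: "continuous_on II q" "(q \<longlongrightarrow> q0m) (at_left 0)" "(q \<longlongrightarrow> q0p) (at_right 0)"
    and E: "eigenelement (dom_A a1 a2 q \<beta>1 \<beta>2 \<delta>1 \<delta>2) (op_A a1 a2 q \<beta>1 \<beta>2 \<delta>1 \<delta>2) \<mu> F"
  obtains w where "P_eigenfunction a1 a2 q \<beta>1 \<beta>2 \<delta>1 \<delta>2 \<mu> w" "represents w (fst F)"
proof -
  obtain u where rep: "dom_rep a1 a2 q \<beta>1 \<beta>2 \<delta>1 \<delta>2 F u"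
    using E by (auto simp: eigenelement_def dom_A_def)
  have F: "F = element_of \<delta>1 \<delta>2 u" and R: "sq_int u" "\<forall>i<3. \<forall>x\<in>inner_II. Dn i u differentiable (at x)"
    "\<forall>i\<le>3. AC_loc {-1<..<0} (Dn i u) \<and> AC_loc {0<..<1} (Dn i u)"
    "AE x in lebesgue_on II. Dn 1 (au2 a1 a2 u) differentiable (at x)"
    "L1 u = 0" "L2 \<beta>1 \<beta>2 u = 0" "L3 u = 0" "L4 u = 0"
    using rep unfolding dom_rep_iff by blast+
  have A: "op_A a1 a2 q \<beta>1 \<beta>2 \<delta>1 \<delta>2 F = scale_Z \<mu> F" using E by (simp add: eigenelement_def)
  then have eq: "AE x in lebesgue_on II. L a1 a2 q u x = \<mu> * u x"
    and cond: "L5 \<delta>1 \<mu> u = 0" "L6 \<delta>2 \<mu> u = 0" "L7 \<mu> u = 0" "L8 \<mu> u = 0"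
    unfolding eigen_equation_iff[OF rep] by blast+
  have ci: "classical_on a1 a2 q \<mu> inner_II u"
    by (rule AE_equation_imp_classical[OF a q(1) _ _ _ R(4) eq]) (use R(2,3) in blast)+
  note ext = classical_on_extends[OF q ci R(1)]
  obtain w where w: "classical_on a1 a2 q \<mu> II w" "\<And>x. x \<in> inner_II \<Longrightarrow> w x = u x"
    using classical_on_endpoints[OF a q ci ext] by blast
  then have wu: "\<forall>x\<in>inner_II. w x = u x" by blast
  have lim: "(\<exists>l. (Dn i w \<longlongrightarrow> l) (at_left 0)) \<and> (\<exists>l. (Dn i w \<longlongrightarrow> l) (at_right 0))" if i: "i \<le> 3" for i
  proof -
    have "extends_to_Icc p r (Dn i w) \<and> continuous_on {p<..<r} (Dn i w)" if pr: "half p r" for p r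
    proof
      have "Dn i w x = Dn i u x" if "x \<in> {p<..<r}" for x
        by (rule Dn_inner_cong[OF w(2)]) (use that half_subset(1)[OF pr] in auto)
      then show "extends_to_Icc p r (Dn i w)" using ext[OF pr i] by (simp add: extends_to_Icc_def)
      show "continuous_on {p<..<r} (Dn i w)"
        by (rule classical_on_continuous_half[OF classical_on_subset[OF w(1) inner_II_subset] pr i])
    qed
    from this[of "-1" 0] this[of 0 1] show ?thesis
      using extends_to_Icc_iff_limits[of "-1" 0 "Dn i w"] extends_to_Icc_iff_limits[of 0 1 "Dn i w"]
      by (simp add: half_def)
  qed
  have "P_solution a1 a2 q \<beta>1 \<beta>2 \<delta>1 \<delta>2 \<mu> w"
    using w(1) lim R(5-8) cond unfolding classical_on_II_iff[OF a] P_solution_def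
      conditions_inner_cong[OF wu] by blast
  moreover have sqw: "sq_int w" by (rule P_solution_classical(2)[OF a calculation])
  moreover have "AE x in lebesgue_on II. w x = u x" by (rule AE_II_I[OF w(2)])
  then have "represents w (fst F)"
    using abs_l2_eq_iff[OF sqw R(1)] sqw by (simp add: represents_def F element_of_def)
  moreover have "\<exists>x\<in>II. w x \<noteq> 0"
  proof -
    have "element_of \<delta>1 \<delta>2 u \<noteq> 0" using E F by (simp add: eigenelement_def)
    moreover have "continuous_on inner_II u"
    proof (rule continuous_at_imp_continuous_on, rule ballI)
      show "continuous (at x) u" if "x \<in> inner_II" for x
        using classical_on_continuous[OF ci that, of 0] at_within_II_inner[OF that] by simp
    qed
    ultimately have "\<exists>x\<in>inner_II. u x \<noteq> 0" using element_of_eq_0_iff[OF R(1)] by blast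
    then show ?thesis using w(2) inner_II_subset by (metis subsetD)
  qed
  ultimately show ?thesis using that by (simp add: P_eigenfunction_def)
qed

theorem theorem2p1:
  fixes a1 a2 \<beta>1 \<beta>2 \<delta>1 \<delta>2 q0m q0p :: real and q :: "real \<Rightarrow> real" and \<mu> :: complex
  assumes "a1 > 0" and "a2 > 0"
    and "continuous_on II q"
    and "(q \<longlongrightarrow> q0m) (at_left 0)" and "(q \<longlongrightarrow> q0p) (at_right 0)"
    and "\<bar>\<beta>1\<bar> + \<bar>\<beta>2\<bar> \<noteq> 0" and "\<bar>\<delta>1\<bar> + \<bar>\<delta>2\<bar> \<noteq> 0"
  shows "(P_eigenvalue a1 a2 q \<beta>1 \<beta>2 \<delta>1 \<delta>2 \<mu> \<longleftrightarrow>
            eigenvalue (dom_A a1 a2 q \<beta>1 \<beta>2 \<delta>1 \<delta>2) (op_A a1 a2 q \<beta>1 \<beta>2 \<delta>1 \<delta>2) \<mu>) \<and>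
         (\<forall>u. P_eigenfunction a1 a2 q \<beta>1 \<beta>2 \<delta>1 \<delta>2 \<mu> u \<longrightarrow> sq_int u) \<and>
         {f. \<exists>u. P_eigenfunction a1 a2 q \<beta>1 \<beta>2 \<delta>1 \<delta>2 \<mu> u \<and> represents u f} =
         {f. \<exists>h1 h2 h3 h4. eigenelement (dom_A a1 a2 q \<beta>1 \<beta>2 \<delta>1 \<delta>2)
               (op_A a1 a2 q \<beta>1 \<beta>2 \<delta>1 \<delta>2) \<mu> (f, h1, h2, h3, h4)}"
proof -
  note to_A = P_eigenfunction_eigenelement[OF assms(1,2,3)]
  note to_P = eigenelement_P_eigenfunction[OF assms(1,2,3,4,5)]
  show ?thesis
  proof (intro conjI allI impI)
    show "P_eigenvalue a1 a2 q \<beta>1 \<beta>2 \<delta>1 \<delta>2 \<mu> \<longleftrightarrow>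
            eigenvalue (dom_A a1 a2 q \<beta>1 \<beta>2 \<delta>1 \<delta>2) (op_A a1 a2 q \<beta>1 \<beta>2 \<delta>1 \<delta>2) \<mu>"
      unfolding P_eigenvalue_def eigenvalue_def using to_A to_P by blast
    show "sq_int u" if "P_eigenfunction a1 a2 q \<beta>1 \<beta>2 \<delta>1 \<delta>2 \<mu> u" for u
      using that P_solution_classical(2)[OF assms(1,2)] unfolding P_eigenfunction_def by blast
    show "{f. \<exists>u. P_eigenfunction a1 a2 q \<beta>1 \<beta>2 \<delta>1 \<delta>2 \<mu> u \<and> represents u f} =
         {f. \<exists>h1 h2 h3 h4. eigenelement (dom_A a1 a2 q \<beta>1 \<beta>2 \<delta>1 \<delta>2)
               (op_A a1 a2 q \<beta>1 \<beta>2 \<delta>1 \<delta>2) \<mu> (f, h1, h2, h3, h4)}"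
    proof (intro equalityI subsetI; clarify)
      fix f u assume "P_eigenfunction a1 a2 q \<beta>1 \<beta>2 \<delta>1 \<delta>2 \<mu> u" and "represents u f"
      then show "\<exists>h1 h2 h3 h4. eigenelement (dom_A a1 a2 q \<beta>1 \<beta>2 \<delta>1 \<delta>2)
               (op_A a1 a2 q \<beta>1 \<beta>2 \<delta>1 \<delta>2) \<mu> (f, h1, h2, h3, h4)"
        using to_A unfolding element_of_def represents_def by blast
    next
      fix f h1 h2 h3 h4
      assume "eigenelement (dom_A a1 a2 q \<beta>1 \<beta>2 \<delta>1 \<delta>2) (op_A a1 a2 q \<beta>1 \<beta>2 \<delta>1 \<delta>2) \<mu> (f, h1, h2, h3, h4)"
      then show "\<exists>u. P_eigenfunction a1 a2 q \<beta>1 \<beta>2 \<delta>1 \<delta>2 \<mu> u \<and> represents u f"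
        by (rule to_P) auto
    qed
  qed
qed

end
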